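(* Let $F$ be a stabilizing state feedback for the system $\Sigma=(A,B,C,D)$ (with $A+BF$ having no Jordan chains). Then $F$ achieves state-to-output decoupling if and only if there exist square real matrices $A_1,\ldots,A_p$, with $A_i$ acting on $\mathcal X_i=\mathbb R^{n_i}$, and real row vectors $C_1,\ldots,C_p$ (with $C_i\in\mathbb R^{1\times n_i}$) such that both of the following hold: (i) to any $x_0\in\mathcal X=\mathbb R^n$ it is possible to associate $x_{1,0}\in\mathcal X_1,\ldots,x_{p,0}\in\mathcal X_p$ such that $$(C+DF)\,e^{(A+BF)t}x_0=\begin{bmatrix} C_1e^{A_1t}x_{1,0}\\ \vdots\\ C_pe^{A_pt}x_{p,0}\end{bmatrix}\qquad\text{for all } t\ge 0 ; \qquad ( * )$$ (ii) conversely, for any choice of $x_{1,0}\in\mathcal X_1,\ldots,x_{p,0}\in\mathcal X_p$ there exists $x_0\in\mathcal X$ such that $( * )$ holds. (In discrete time, the exponentials $e^{Mt}$ in $( * )$ are replaced by the powers $M^t$, $t\in\mathbb N$.)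
   Context: $\Sigma$ is the LTI system $\mathcal D x(t)=Ax(t)+Bu(t)$, $y(t)=Cx(t)+Du(t)$, with $x(t)\in\mathbb R^n$, $u(t)\in\mathbb R^m$, $y(t)\in\mathbb R^p$ and real matrices $A,B,C,D$; $\mathcal D x$ is $\dot x(t)$ in continuous time and $x(t+1)$ in discrete time. $\mathbb C_g$ is the open left half-plane (continuous time) or the open unit disc (discrete time). Standing assumptions: $\Sigma$ is right invertible (its transfer matrix $C(\lambda I-A)^{-1}B+D$ is right invertible as a rational matrix), stabilizable, and has no invariant zero at $0$ (continuous time) or $1$ (discrete time), an invariant zero being a $\lambda\in\mathbb C$ at which $\begin{bmatrix}A-\lambda I&B\\C&D\end{bmatrix}$ has rank smaller than its normal rank. The control is $u=Fx+Gr$ with $F$ real and stabilizing ($\sigma(A+BF)\subset\mathbb C_g$) and $G$ a right inverse of the closed-loop static gain. For constant reference $r$, the error $\epsilon=y-r$ satisfies $\mathcal D\xi=(A+BF)\xi$, $\epsilon=(C+DF)\xi$, $\xi(0)=\xi_0$, where $\xi$ is $x$ translated by the steady state. With $r=0$ the response of the closed loop from $x_0$ is the left-hand side of $( * )$. The matrix $A+BF$ is assumed to have no Jordan chains, i.e. to be diagonalizable over $\mathbb C$. State-to-output decoupling: $F$ achieves state-to-output decoupling if for any initial condition the $i$-th component of the error can be written as $\epsilon_i(t)=\beta_{i,1}e^{\lambda_{i,1}t}+\cdots+\beta_{i,\nu_i}e^{\lambda_{i,\nu_i}t}$ (respectively $\beta_{i,1}\lambda_{i,1}^t+\cdots+\beta_{i,\nu_i}\lambda_{i,\nu_i}^t$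 in discrete time), $i=1,\ldots,p$, where the $\lambda_{i,j}$ are the observable closed-loop eigenvalues; each $\beta_{i,j}$ with $\lambda_{i,j}$ real can be made arbitrary (real) by choice of $\xi_0$; and if $\lambda_{i,j}$ is non-real there is $k$ with $\lambda_{i,k}=\overline{\lambda}_{i,j}$, $\beta_{i,k}=\overline{\beta}_{i,j}$, where $\beta_{i,j}$ can be made arbitrary by choice of $\xi_0$. The arbitrariness is mode by mode along distinct closed-loop eigenvectors; i.e. $A+BF$ has a basis of eigenvectors (closed under conjugation up to indexing) $v_{0,1},\ldots,v_{0,\nu_0},v_{1,1},\ldots,v_{p,\nu_p}$ with eigenvalues $\lambda_{i,j}$ such that $(C+DF)v_{0,j}=0$ and, for $i\ge1$, $(C+DF)v_{i,j}$ is a nonzero multiple of the $i$-th canonical basis vector $e_i$ of $\mathbb R^p$. *)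

theory Defs
  imports
    Complex_Main
    "HOL-Computational_Algebra.Fraction_Field"
    "Jordan_Normal_Form.Gauss_Jordan_Elimination"
    "Jordan_Normal_Form.DL_Rank"
    "Jordan_Normal_Form.Spectral_Radius"
begin

section \<open>Time domains\<close>

datatype time_domain = Continuous | Discrete

text \<open>Signals of both kinds are functions of a real time argument; only their values at the
  times below matter, so in discrete time \<open>nat \<lfloor>t\<rfloor>\<close> merely turns the real number \<open>t\<close> back
  into the natural number it is.\<close>

fun times :: "time_domain \<Rightarrow> real set" where
  "times Continuous = {0..}"
| "times Discrete = \<nat>"

fun stability_region :: "time_domain \<Rightarrow> complex set" where
  "stability_region Continuous = {z. Re z < 0}"
| "stability_region Discrete = {z. cmod z < 1}"

text \<open>The point at which no invariant zero is allowed: the frequency of constant signals.\<close>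

fun dc_point :: "time_domain \<Rightarrow> complex" where
  "dc_point Continuous = 0"
| "dc_point Discrete = 1"

fun mode :: "time_domain \<Rightarrow> complex \<Rightarrow> real \<Rightarrow> complex" where
  "mode Continuous l t = exp (l * of_real t)"
| "mode Discrete l t = l ^ nat \<lfloor>t\<rfloor>"

definition mat_exp :: "real mat \<Rightarrow> real mat" where
  "mat_exp M = mat (dim_row M) (dim_row M) (\<lambda>(i, j). \<Sum>k. (M ^\<^sub>m k) $$ (i, j) / fact k)"

fun propagator :: "time_domain \<Rightarrow> real mat \<Rightarrow> real \<Rightarrow> real mat" where
  "propagator Continuous M t = mat_exp (t \<cdot>\<^sub>m M)"
| "propagator Discrete M t = M ^\<^sub>m nat \<lfloor>t\<rfloor>"

fun autonomous_dynamics :: "time_domain \<Rightarrow> real mat \<Rightarrow> (real \<Rightarrow> real vec) \<Rightarrow> bool" where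
  "autonomous_dynamics Continuous M \<xi> \<longleftrightarrow>
     (\<forall>t\<ge>0. \<forall>i<dim_row M.
        ((\<lambda>s. \<xi> s $ i) has_real_derivative (M *\<^sub>v \<xi> t) $ i) (at t within {0..}))"
| "autonomous_dynamics Discrete M \<xi> \<longleftrightarrow> (\<forall>t\<in>\<nat>. \<xi> (t + 1) = M *\<^sub>v \<xi> t)"

definition trajectory :: "time_domain \<Rightarrow> real mat \<Rightarrow> real vec \<Rightarrow> (real \<Rightarrow> real vec) \<Rightarrow> bool" where
  "trajectory td M \<xi>0 \<xi> \<longleftrightarrow>
     (\<forall>t\<in>times td. \<xi> t \<in> carrier_vec (dim_row M)) \<and> \<xi> 0 = \<xi>0 \<and> autonomous_dynamics td M \<xi>"


section \<open>System-theoretic properties\<close>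

abbreviation cmat :: "real mat \<Rightarrow> complex mat" where
  "cmat \<equiv> map_mat complex_of_real"

text \<open>Rational functions in one indeterminate are elements of \<open>real poly fract\<close>.\<close>

definition rat_const :: "real \<Rightarrow> real poly fract" where
  "rat_const c = Fract [:c:] 1"

definition rat_var :: "real poly fract" where
  "rat_var = Fract [:0, 1:] 1"

text \<open>The characteristic polynomial of \<open>A\<close> is nonzero, so for square \<open>A\<close> the value of
  \<open>mat_inverse\<close> below is never \<open>None\<close>.\<close>

definition transfer_matrix ::
  "real mat \<Rightarrow> real mat \<Rightarrow> real mat \<Rightarrow> real mat \<Rightarrow> real poly fract mat" where
  "transfer_matrix A B C D =
     map_mat rat_const C
       * the (mat_inverse (rat_var \<cdot>\<^sub>m 1\<^sub>m (dim_row A) - map_mat rat_const A))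
       * map_mat rat_const B
     + map_mat rat_const D"

definition right_invertible :: "real mat \<Rightarrow> real mat \<Rightarrow> real mat \<Rightarrow> real mat \<Rightarrow> bool" where
  "right_invertible A B C D \<longleftrightarrow>
     (\<exists>R \<in> carrier_mat (dim_col B) (dim_row C). transfer_matrix A B C D * R = 1\<^sub>m (dim_row C))"

definition stabilizing :: "time_domain \<Rightarrow> real mat \<Rightarrow> real mat \<Rightarrow> real mat \<Rightarrow> bool" where
  "stabilizing td A B F \<longleftrightarrow> spectrum (cmat (A + B * F)) \<subseteq> stability_region td"

definition stabilizable :: "time_domain \<Rightarrow> real mat \<Rightarrow> real mat \<Rightarrow> bool" where
  "stabilizable td A B \<longleftrightarrow> (\<exists>F \<in> carrier_mat (dim_col B) (dim_row A). stabilizing td A B F)"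

definition system_pencil_at ::
  "real mat \<Rightarrow> real mat \<Rightarrow> real mat \<Rightarrow> real mat \<Rightarrow> complex \<Rightarrow> complex mat" where
  "system_pencil_at A B C D l =
     four_block_mat (cmat A - l \<cdot>\<^sub>m 1\<^sub>m (dim_row A)) (cmat B) (cmat C) (cmat D)"

text \<open>The normal rank of a polynomial matrix is its rank over the field of rational
  functions.\<close>

definition system_normal_rank :: "real mat \<Rightarrow> real mat \<Rightarrow> real mat \<Rightarrow> real mat \<Rightarrow> nat" where
  "system_normal_rank A B C D =
     vec_space.rank (dim_row A + dim_row C)
       (four_block_mat (map_mat rat_const A - rat_var \<cdot>\<^sub>m 1\<^sub>m (dim_row A)) (map_mat rat_const B)
                       (map_mat rat_const C) (map_mat rat_const D))"

definition invariant_zero ::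
  "real mat \<Rightarrow> real mat \<Rightarrow> real mat \<Rightarrow> real mat \<Rightarrow> complex \<Rightarrow> bool" where
  "invariant_zero A B C D l \<longleftrightarrow>
     vec_space.rank (dim_row A + dim_row C) (system_pencil_at A B C D l)
       < system_normal_rank A B C D"

definition diagonalizable_over_complex :: "real mat \<Rightarrow> bool" where
  "diagonalizable_over_complex M \<longleftrightarrow> (\<exists>L. diagonal_mat L \<and> similar_mat (cmat M) L)"


section \<open>State-to-output decoupling\<close>

text \<open>Below \<open>M\<close> and \<open>H\<close> stand for the closed-loop matrices \<open>A + B F\<close> and \<open>C + D F\<close>, with
  \<open>n\<close> and \<open>p\<close> rows.  Modes are indexed by the pairs \<open>(i, j)\<close> with \<open>i \<le> p\<close> and \<open>j < \<nu> i\<close>: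
  the modes with \<open>i = 0\<close> are unobservable, those with index \<open>Suc i\<close> belong to the output
  component \<open>i\<close>, where \<open>i\<close> ranges over \<open>{0..<p}\<close>.  The function \<open>\<kappa>\<close> is the reindexing that
  realizes complex conjugation.\<close>

definition mode_index :: "nat \<Rightarrow> (nat \<Rightarrow> nat) \<Rightarrow> (nat \<times> nat) set" where
  "mode_index p \<nu> = (SIGMA i:{..p}. {..<\<nu> i})"

definition decoupled_eigenbasis ::
  "real mat \<Rightarrow> real mat \<Rightarrow> (nat \<Rightarrow> nat) \<Rightarrow> (nat \<Rightarrow> nat \<Rightarrow> complex) \<Rightarrow> (nat \<Rightarrow> nat \<Rightarrow> nat)
   \<Rightarrow> (nat \<Rightarrow> nat \<Rightarrow> complex vec) \<Rightarrow> bool" where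
  "decoupled_eigenbasis M H \<nu> \<Lambda> \<kappa> v \<longleftrightarrow>
     (let n = dim_row M; p = dim_row H in
       (\<forall>(i, j) \<in> mode_index p \<nu>. eigenvector (cmat M) (v i j) (\<Lambda> i j)) \<and>
       inj_on (\<lambda>(i, j). v i j) (mode_index p \<nu>) \<and>
       vectorspace.basis class_ring (module_vec TYPE(complex) n)
         ((\<lambda>(i, j). v i j) ` mode_index p \<nu>) \<and>
       (\<forall>(i, j) \<in> mode_index p \<nu>. \<kappa> i j < \<nu> i \<and>
          v i (\<kappa> i j) = conjugate (v i j) \<and> \<Lambda> i (\<kappa> i j) = cnj (\<Lambda> i j)) \<and>
       (\<forall>j < \<nu> 0. cmat H *\<^sub>v v 0 j = 0\<^sub>v p) \<and>
       (\<forall>i < p. \<forall>j < \<nu> (Suc i).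
          \<exists>c. c \<noteq> 0 \<and> cmat H *\<^sub>v v (Suc i) j = c \<cdot>\<^sub>v unit_vec p i))"

definition admissible_coefficients ::
  "nat \<Rightarrow> (nat \<Rightarrow> nat) \<Rightarrow> (nat \<Rightarrow> nat \<Rightarrow> complex) \<Rightarrow> (nat \<Rightarrow> nat \<Rightarrow> nat)
   \<Rightarrow> (nat \<Rightarrow> nat \<Rightarrow> complex) \<Rightarrow> bool" where
  "admissible_coefficients p \<nu> \<Lambda> \<kappa> \<beta> \<longleftrightarrow>
     (\<forall>i < p. \<forall>j < \<nu> (Suc i).
        if \<Lambda> (Suc i) j \<in> \<real> then \<beta> (Suc i) j \<in> \<real>
        else \<beta> (Suc i) (\<kappa> (Suc i) j) = cnj (\<beta> (Suc i) j))"

definition modal_error ::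
  "time_domain \<Rightarrow> real mat \<Rightarrow> (nat \<Rightarrow> nat) \<Rightarrow> (nat \<Rightarrow> nat \<Rightarrow> complex)
   \<Rightarrow> (nat \<Rightarrow> nat \<Rightarrow> complex) \<Rightarrow> (real \<Rightarrow> real vec) \<Rightarrow> bool" where
  "modal_error td H \<nu> \<Lambda> \<beta> \<xi> \<longleftrightarrow>
     (\<forall>i < dim_row H. \<forall>t \<in> times td.
        complex_of_real ((H *\<^sub>v \<xi> t) $ i)
          = (\<Sum>j<\<nu> (Suc i). \<beta> (Suc i) j * mode td (\<Lambda> (Suc i) j) t))"

definition state_to_output_decoupling ::
  "time_domain \<Rightarrow> real mat \<Rightarrow> real mat \<Rightarrow> real mat \<Rightarrow> real mat \<Rightarrow> real mat \<Rightarrow> bool" where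
  "state_to_output_decoupling td A B C D F \<longleftrightarrow>
     (let M = A + B * F; H = C + D * F; n = dim_row M; p = dim_row H in
       \<exists>\<nu> \<Lambda> \<kappa> v. decoupled_eigenbasis M H \<nu> \<Lambda> \<kappa> v \<and>
         (\<forall>\<xi>0 \<in> carrier_vec n. \<forall>\<xi>. trajectory td M \<xi>0 \<xi> \<longrightarrow>
            (\<exists>\<beta>. admissible_coefficients p \<nu> \<Lambda> \<kappa> \<beta> \<and> modal_error td H \<nu> \<Lambda> \<beta> \<xi>)) \<and>
         (\<forall>\<beta>. admissible_coefficients p \<nu> \<Lambda> \<kappa> \<beta> \<longrightarrow>
            (\<exists>\<xi>0 \<in> carrier_vec n. \<exists>\<xi>. trajectory td M \<xi>0 \<xi> \<and> modal_error td H \<nu> \<Lambda> \<beta> \<xi>)))"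


section \<open>The decoupled response identity\<close>

definition decoupled_response ::
  "time_domain \<Rightarrow> real mat \<Rightarrow> real mat \<Rightarrow> real mat \<Rightarrow> real mat \<Rightarrow> real mat
   \<Rightarrow> (nat \<Rightarrow> real mat) \<Rightarrow> (nat \<Rightarrow> real mat) \<Rightarrow> real vec \<Rightarrow> (nat \<Rightarrow> real vec) \<Rightarrow> bool" where
  "decoupled_response td A B C D F As Cs x0 xs \<longleftrightarrow>
     (\<forall>t \<in> times td.
        ((C + D * F) * propagator td (A + B * F) t) *\<^sub>v x0
          = vec (dim_row C) (\<lambda>i. ((Cs i * propagator td (As i) t) *\<^sub>v xs i) $ 0))"

end

theory Submission
  imports Defs
begin

text \<open>
  Write \<open>M = A + B F\<close> and \<open>H = C + D F\<close>.  If a decoupled eigenbasis exists, the realizations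
  can all be taken to be \<open>M\<close> itself with output the \<open>i\<close>-th row of \<open>H\<close>: given \<open>x\<^sub>1, \<dots>, x\<^sub>p\<close>, the
  sum of the components of the \<open>x\<^sub>i\<close> along the modes of output \<open>i\<close> is an initial state as in (ii).

  Conversely, (i) followed by (ii), with all but the \<open>i\<close>-th initial state replaced by \<open>0\<close>, shows
  that the response from any \<open>x\<close> with all outputs except the \<open>i\<close>-th suppressed is again a response.
  Since modes of distinct exponents are linearly independent, this holds within each
  eigenspace of \<open>M\<close>.  Hence every eigenvector is a sum of eigenvectors in \<open>ker H\<close> and eigenvectors
  mapped by \<open>H\<close> to multiples of unit vectors.  A largest linearly independent, conjugation-closed
  family of such vectors, real for real eigenvalues, spans the whole space.
\<close>

subsection \<open>Modes\<close>

lemma mode_0 [simp]: "mode td l 0 = 1"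
  by (cases td) auto

lemma zero_in_times [simp]: "0 \<in> times td"
  by (cases td) auto

lemma times_nonneg: "t \<in> times td \<Longrightarrow> 0 \<le> t"
  by (cases td) (auto elim: Nats_cases)

lemma times_add: "s \<in> times td \<Longrightarrow> t \<in> times td \<Longrightarrow> s + t \<in> times td"
  by (cases td) (auto elim!: Nats_cases simp: Nats_add)

lemma mode_add:
  assumes "s \<in> times td" "t \<in> times td"
  shows "mode td l (s + t) = mode td l s * mode td l t"
proof (cases td)
  case Continuous
  then show ?thesis
    by (simp add: exp_add distrib_left)
next
  case Discrete
  then obtain j k where "s = of_nat j" "t = of_nat k"
    using assms by (auto elim!: Nats_cases)
  moreover have "nat \<lfloor>of_nat j + of_nat k :: real\<rfloor> = j + k"
    by (metis floor_of_nat nat_int of_nat_add)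
  ultimately show ?thesis
    using Discrete by (simp add: power_add)
qed

lemma mode_cnj: "cnj (mode td l t) = mode td (cnj l) t"
  by (cases td) (auto simp: complex_eq_iff Re_exp Im_exp)

text \<open>No single time works for every \<open>a\<close>, because \<open>exp\<close> has
  imaginary periods. Off the imaginary axis the modulus at time 1 already differs from 1; on it,
  half a period turns the exponential into -1.\<close>

lemma exp_scaled_ne_1:
  assumes "a \<noteq> (0::complex)"
  obtains s :: real where "s \<ge> 0" "exp (a * of_real s) \<noteq> 1"
proof (cases "Re a = 0")
  case False
  have "cmod (exp (a * of_real 1)) \<noteq> 1"
    using False by simp
  then have "exp (a * of_real 1) \<noteq> 1"
    by (metis norm_one)
  then show ?thesis
    using that[of 1] by simp
next
  case True
  then have b: "Im a \<noteq> 0"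
    using assms by (auto simp: complex_eq_iff)
  define s where "s = pi / \<bar>Im a\<bar>"
  have "cos (Im a * s) = - 1"
    using b by (cases "Im a > 0") (auto simp: s_def)
  then have "Re (exp (a * of_real s)) = - 1"
    using True by (simp add: Re_exp)
  then have "exp (a * of_real s) \<noteq> 1"
    by force
  then show ?thesis
    using that[of s] by (simp add: s_def)
qed

lemma mode_separates:
  assumes "l \<noteq> k"
  obtains s where "s \<in> times td" "mode td l s \<noteq> mode td k s"
proof (cases td)
  case Continuous
  obtain s :: real where s: "s \<ge> 0" "exp ((l - k) * of_real s) \<noteq> 1"
    using assms exp_scaled_ne_1[of "l - k"] by auto
  have "exp (l * of_real s) \<noteq> exp (k * of_real s)"
    using s(2) by (auto simp: left_diff_distrib exp_diff)
  then show ?thesis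
    using that[of s] s(1) Continuous by auto
next
  case Discrete
  then show ?thesis
    using that[of 1] assms by auto
qed

text \<open>Induction on the set of exponents. Shifting the relation by \<open>s\<close> and
  subtracting \<open>mode td k s\<close> times the original cancels the term of \<open>k\<close> and
  multiplies the coefficient of \<open>l\<close> by \<open>mode td l s - mode td k s\<close>, which
  is nonzero for a suitable \<open>s\<close>. Evaluation at time 0 then gives
  \<open>c k = 0\<close>.\<close>

lemma modes_independent:
  assumes "finite S"
    and "\<And>t. t \<in> times td \<Longrightarrow> (\<Sum>l\<in>S. c l * mode td l t) = 0"
    and "l \<in> S"
  shows "c l = 0"
  using assms
proof (induction S arbitrary: c l rule: finite_induct)
  case empty
  then show ?case by simp
next
  case (insert k S)
  have zero: "c l = 0" if "l \<in> S" for l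
  proof -
    have "l \<noteq> k"
      using insert.hyps that by auto
    then obtain s where s: "s \<in> times td" "mode td l s \<noteq> mode td k s"
      by (rule mode_separates)
    have "(\<Sum>l\<in>S. c l * (mode td l s - mode td k s) * mode td l t) = 0" if t: "t \<in> times td" for t
    proof -
      have "(\<Sum>l\<in>insert k S. c l * mode td l (s + t)) - mode td k s * (\<Sum>l\<in>insert k S. c l * mode td l t)
          = (\<Sum>l\<in>insert k S. c l * (mode td l s - mode td k s) * mode td l t)"
        by (simp only: mode_add[OF s(1) t] sum_distrib_left sum_subtractf[symmetric] algebra_simps)
      then show ?thesis
        using insert.prems(1)[OF t] insert.prems(1)[OF times_add[OF s(1) t]] insert.hyps
        by simp
    qed
    from insert.IH[OF this that] show ?thesis
      using s(2) by simp
  qed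
  then have "c k = 0"
    using insert.prems(1)[OF zero_in_times] insert.hyps by simp
  with zero insert.prems(2) show ?case
    by auto
qed

subsection \<open>Real and complex vectors\<close>

abbreviation cvec :: "real vec \<Rightarrow> complex vec" where
  "cvec \<equiv> map_vec complex_of_real"

lemma cmat_mult: "A \<in> carrier_mat a b \<Longrightarrow> B \<in> carrier_mat b c \<Longrightarrow> cmat (A * B) = cmat A * cmat B"
  by (rule of_real_hom.mat_hom_mult)

lemma cmat_mult_vec: "A \<in> carrier_mat a b \<Longrightarrow> x \<in> carrier_vec b \<Longrightarrow> cvec (A *\<^sub>v x) = cmat A *\<^sub>v cvec x"
  by (rule of_real_hom.mult_mat_vec_hom)

lemma mult_mat_vec_index_sum:
  "A \<in> carrier_mat a b \<Longrightarrow> x \<in> carrier_vec b \<Longrightarrow> i < a \<Longrightarrow> (A *\<^sub>v x) $ i = (\<Sum>j<b. A $$ (i, j) * x $ j)"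
  by (auto simp: scalar_prod_def lessThan_atLeast0 intro!: sum.cong)

text \<open>Turns complex combinations of eigenvectors into real initial states with known
  outputs.\<close>

lemma Re_cmat_mult_vec:
  "A \<in> carrier_mat a b \<Longrightarrow> x \<in> carrier_vec b \<Longrightarrow> i < a \<Longrightarrow> (A *\<^sub>v map_vec Re x) $ i = Re ((cmat A *\<^sub>v x) $ i)"
  by (subst (1 2) mult_mat_vec_index_sum[of _ a b]) auto

lemma conjugate_cmat_mult_vec:
  assumes "A \<in> carrier_mat a b" "x \<in> carrier_vec b"
  shows "cmat A *\<^sub>v conjugate x = conjugate (cmat A *\<^sub>v x)"
proof (rule eq_vecI)
  fix i assume "i < dim_vec (conjugate (cmat A *\<^sub>v x))"
  then have i: "i < a"
    using assms by auto
  then have "(cmat A *\<^sub>v conjugate x) $ i = (\<Sum>j<b. complex_of_real (A $$ (i, j)) * cnj (x $ j))"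
    using assms by (subst mult_mat_vec_index_sum[of _ a b]) auto
  also have "\<dots> = cnj ((cmat A *\<^sub>v x) $ i)"
    using assms i by (subst mult_mat_vec_index_sum[of _ a b]) auto
  finally show "(cmat A *\<^sub>v conjugate x) $ i = conjugate (cmat A *\<^sub>v x) $ i"
    using i assms by auto
qed (use assms in auto)

subsection \<open>Diagonalizable real matrices\<close>

lemma pow_mat_smult:
  fixes c :: "'a :: comm_ring_1"
  assumes "A \<in> carrier_mat n n"
  shows "(c \<cdot>\<^sub>m A) ^\<^sub>m k = c ^ k \<cdot>\<^sub>m (A ^\<^sub>m k)"
proof (induction k)
  case (Suc k)
  have smult_smult_assoc: "a \<cdot>\<^sub>m (b \<cdot>\<^sub>m X) = (a * b) \<cdot>\<^sub>m X" for a b :: 'a and X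
    by (rule eq_matI) (auto simp: mult.assoc)
  have "c ^ k \<cdot>\<^sub>m (A ^\<^sub>m k) * (c \<cdot>\<^sub>m A) = (c * c ^ k) \<cdot>\<^sub>m (A ^\<^sub>m k * A)"
    using assms
    by (simp add: mult_smult_distrib[of _ n n _ n] mult_smult_assoc_mat[of _ n n _ n]
        mult_carrier_mat[of _ n n] smult_smult_assoc)
  then show ?case
    by (simp add: Suc mult.commute)
qed (rule eq_matI, use assms in auto)

section \<open>Functional calculus of a diagonalized matrix\<close>

locale diagonalized =
  fixes n :: nat and M :: "real mat" and P Q :: "complex mat" and l :: "nat \<Rightarrow> complex"
  assumes M: "M \<in> carrier_mat n n" and P: "P \<in> carrier_mat n n" and Q: "Q \<in> carrier_mat n n"
    and PQ: "P * Q = 1\<^sub>m n" and QP: "Q * P = 1\<^sub>m n"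
    and M_eq: "cmat M = P * mat_diag n l * Q"
begin

text \<open>The matrix \<open>f(M)\<close>. Powers, exponentials and spectral projections are all
  instances, which allows one treatment of both time domains.\<close>

definition fcalc :: "(complex \<Rightarrow> complex) \<Rightarrow> complex mat" where
  "fcalc f = P * mat_diag n (\<lambda>k. f (l k)) * Q"

lemma fcalc_carrier [simp]: "fcalc f \<in> carrier_mat n n"
  using P Q by (auto simp: fcalc_def)

lemma fcalc_index:
  assumes "i < n" "j < n"
  shows "fcalc f $$ (i, j) = (\<Sum>k<n. P $$ (i, k) * f (l k) * Q $$ (k, j))"
proof -
  have "P * mat_diag n (\<lambda>k. f (l k)) = mat n n (\<lambda>(i, k). P $$ (i, k) * f (l k))"
    by (rule mat_diag_mult_right[OF P])
  then show ?thesis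
    using assms P Q
    by (auto simp: fcalc_def scalar_prod_def lessThan_atLeast0 intro!: sum.cong)
qed

lemma fcalc_id: "fcalc (\<lambda>x. x) = cmat M"
  by (simp add: fcalc_def M_eq)

lemma fcalc_1: "fcalc (\<lambda>x. 1) = 1\<^sub>m n"
  using P PQ by (simp add: fcalc_def)

lemma fcalc_mult: "fcalc f * fcalc g = fcalc (\<lambda>x. f x * g x)"
proof -
  let ?D = "\<lambda>f. mat_diag n (\<lambda>k. f (l k))"
  have "fcalc f * fcalc g = P * ?D f * (Q * (P * ?D g * Q))"
    using P Q by (simp add: fcalc_def assoc_mult_mat[of _ n n _ n _ n] mult_carrier_mat[of _ n n])
  also have "Q * (P * ?D g * Q) = (Q * P) * ?D g * Q"
    using P Q by (simp add: assoc_mult_mat[of _ n n _ n _ n] mult_carrier_mat[of _ n n])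
  also have "P * ?D f * ((Q * P) * ?D g * Q) = P * (?D f * ?D g) * Q"
    using P Q
    by (simp add: QP assoc_mult_mat[of _ n n _ n _ n] mult_carrier_mat[of _ n n] left_mult_one_mat[of _ n n] flip: mat_diag_diag)
  finally show ?thesis
    by (simp add: fcalc_def)
qed

lemma fcalc_pow: "cmat (M ^\<^sub>m k) = fcalc (\<lambda>x. x ^ k)"
proof (induction k)
  case 0
  then show ?case
    using M fcalc_1 by (simp add: of_real_hom.mat_hom_one)
next
  case (Suc k)
  have "cmat (M ^\<^sub>m Suc k) = cmat (M ^\<^sub>m k) * cmat M"
    using M by (simp add: cmat_mult[of _ n n _ n])
  then show ?case
    by (simp add: Suc fcalc_id[symmetric] fcalc_mult mult.commute)
qed

text \<open>By diagonalization, each entry of the exponential series is a finite combination of the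
  scalar series of \<open>exp (l q * of_real t)\<close>, and these may be summed one by one.\<close>

lemma mat_exp_index:
  assumes "i < n" "j < n"
  shows "complex_of_real (mat_exp (t \<cdot>\<^sub>m M) $$ (i, j)) = fcalc (\<lambda>x. exp (x * of_real t)) $$ (i, j)"
proof -
  have pow: "((t \<cdot>\<^sub>m M) ^\<^sub>m k) $$ (i, j) = t ^ k * (M ^\<^sub>m k) $$ (i, j)" for k
    using assms M by (simp add: pow_mat_smult[OF M])
  have cpow: "complex_of_real ((M ^\<^sub>m k) $$ (i, j)) = (\<Sum>q<n. P $$ (i, q) * l q ^ k * Q $$ (q, j))" for k
  proof -
    have "complex_of_real ((M ^\<^sub>m k) $$ (i, j)) = cmat (M ^\<^sub>m k) $$ (i, j)"
      using assms M by simp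
    then show ?thesis
      using assms by (simp add: fcalc_pow fcalc_index)
  qed
  have term_eq: "complex_of_real (((t \<cdot>\<^sub>m M) ^\<^sub>m k) $$ (i, j) / fact k)
      = (\<Sum>q<n. P $$ (i, q) * ((l q * of_real t) ^ k /\<^sub>R fact k) * Q $$ (q, j))" for k
    by (simp add: pow cpow scaleR_conv_of_real power_mult_distrib sum_distrib_left sum_divide_distrib
        field_simps)
  have "(\<lambda>k. \<Sum>q<n. P $$ (i, q) * ((l q * of_real t) ^ k /\<^sub>R fact k) * Q $$ (q, j)) sums
      (\<Sum>q<n. P $$ (i, q) * exp (l q * of_real t) * Q $$ (q, j))"
    by (intro sums_sum sums_mult sums_mult2 exp_converges)
  then have sums: "(\<lambda>k. complex_of_real (((t \<cdot>\<^sub>m M) ^\<^sub>m k) $$ (i, j) / fact k)) sums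
      fcalc (\<lambda>x. exp (x * of_real t)) $$ (i, j)"
    using assms by (simp only: term_eq fcalc_index)
  \<comment> \<open>The infinite sum in \<open>mat_exp_def\<close> is meaningful only for a
    convergent series; convergence of the real series is read off from the complex one.\<close>
  have "summable (\<lambda>k. ((t \<cdot>\<^sub>m M) ^\<^sub>m k) $$ (i, j) / fact k)"
    using sums_summable[OF sums] by (simp only: summable_complex_of_real)
  then have *: "(\<lambda>k. ((t \<cdot>\<^sub>m M) ^\<^sub>m k) $$ (i, j) / fact k) sums (mat_exp (t \<cdot>\<^sub>m M) $$ (i, j))"
    using assms M by (simp add: mat_exp_def summable_sums)
  show "complex_of_real (mat_exp (t \<cdot>\<^sub>m M) $$ (i, j)) = fcalc (\<lambda>x. exp (x * of_real t)) $$ (i, j)"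
    using sums_unique2[OF sums_of_real[OF *] sums] .
qed

lemma propagator_carrier [simp]: "propagator td M t \<in> carrier_mat n n"
  using M by (cases td) (auto simp: mat_exp_def)

text \<open>From here on, the two time domains differ mostly through the scalar function
  \<open>mode td\<close> alone.\<close>

lemma cmat_propagator: "cmat (propagator td M t) = fcalc (\<lambda>x. mode td x t)"
proof (cases td)
  case Continuous
  show ?thesis
  proof (rule eq_matI)
    fix i j
    assume "i < dim_row (fcalc (\<lambda>x. mode td x t))" "j < dim_col (fcalc (\<lambda>x. mode td x t))"
    then have "i < n" "j < n"
      using fcalc_carrier by (metis carrier_matD)+
    then show "cmat (propagator td M t) $$ (i, j) = fcalc (\<lambda>x. mode td x t) $$ (i, j)"
      using mat_exp_index[of i j t] propagator_carrier[of td t]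
      by (simp add: Continuous)
  qed (use propagator_carrier[of td t] fcalc_carrier[of "\<lambda>x. mode td x t"] in \<open>auto simp del: fcalc_carrier propagator_carrier\<close>)
qed (simp add: fcalc_pow)

text \<open>In the coordinates \<open>z = Q *\<^sub>v v\<close> the eigenvector equation says
  \<open>l k * z $ k = a * z $ k\<close>. So \<open>z\<close> is supported where
  \<open>l k = a\<close>, and there \<open>f (l k) = f a\<close>.\<close>

lemma fcalc_eigenvector:
  assumes v: "v \<in> carrier_vec n" and eig: "cmat M *\<^sub>v v = a \<cdot>\<^sub>v v"
  shows "fcalc f *\<^sub>v v = f a \<cdot>\<^sub>v v"
proof -
  define z where "z = Q *\<^sub>v v"
  have z: "z \<in> carrier_vec n"
    using Q v by (simp add: z_def)
  have diag: "mat_diag n g *\<^sub>v z = vec n (\<lambda>k. g k * z $ k)" for g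
  proof (rule eq_vecI)
    fix i
    assume "i < dim_vec (vec n (\<lambda>k. g k * z $ k))"
    then have i: "i < n"
      by simp
    have "(mat_diag n g *\<^sub>v z) $ i = (\<Sum>j<n. mat_diag n g $$ (i, j) * z $ j)"
      using z i by (intro mult_mat_vec_index_sum[of _ n n]) auto
    also have "\<dots> = (\<Sum>j<n. if i = j then g j * z $ j else 0)"
      using i by (intro sum.cong) (auto simp: mat_diag_def)
    finally show "(mat_diag n g *\<^sub>v z) $ i = vec n (\<lambda>k. g k * z $ k) $ i"
      using i by simp
  qed (auto simp: mat_diag_def)
  have Pz: "P *\<^sub>v z = v"
    using P Q v PQ by (simp add: z_def assoc_mult_mat_vec[of _ n n _ n, symmetric])
  have "Q *\<^sub>v (cmat M *\<^sub>v v) = (Q * P) *\<^sub>v (mat_diag n l *\<^sub>v z)"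
    using P Q v by (simp add: M_eq z_def assoc_mult_mat_vec[of _ n n _ n] mult_mat_vec_carrier[of _ n n] mult_carrier_mat[of _ n n])
  also have "Q *\<^sub>v (cmat M *\<^sub>v v) = a \<cdot>\<^sub>v z"
    using Q v by (simp add: eig z_def mult_mat_vec[of _ n n])
  finally have "a \<cdot>\<^sub>v z = vec n (\<lambda>k. l k * z $ k)"
    by (simp add: QP diag)
  then have "(a \<cdot>\<^sub>v z) $ k = l k * z $ k" if "k < n" for k
    using that by simp
  then have "a * z $ k = l k * z $ k" if "k < n" for k
    using that z by simp
  then have "f (l k) * z $ k = f a * z $ k" if "k < n" for k
    using that by (cases "z $ k = 0") auto
  then have "mat_diag n (\<lambda>k. f (l k)) *\<^sub>v z = f a \<cdot>\<^sub>v z"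
    using z by (auto simp: diag)
  moreover have "fcalc f *\<^sub>v v = P *\<^sub>v (mat_diag n (\<lambda>k. f (l k)) *\<^sub>v z)"
    using P Q v by (simp add: fcalc_def z_def assoc_mult_mat_vec[of _ n n _ n])
  ultimately show ?thesis
    using P z Pz by (simp add: mult_mat_vec[of _ n n])
qed

lemma propagator_eigenvector:
  assumes "v \<in> carrier_vec n" "cmat M *\<^sub>v v = a \<cdot>\<^sub>v v"
  shows "cmat (propagator td M t) *\<^sub>v v = mode td a t \<cdot>\<^sub>v v"
  using fcalc_eigenvector[OF assms] by (simp add: cmat_propagator)

text \<open>Identities between real matrices are computed with \<open>fcalc\<close> over the complex
  numbers and pulled back.\<close>

lemma inj_cmat: "cmat X = cmat Y \<Longrightarrow> X = Y"
  by (rule of_real_hom.mat_hom_inj)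

lemma propagator_0: "propagator td M 0 = 1\<^sub>m n"
  by (rule inj_cmat) (simp add: cmat_propagator fcalc_1 of_real_hom.mat_hom_one)

subsection \<open>Trajectories\<close>

text \<open>Differentiating the scalar exponentials in \<open>fcalc_index\<close> gives
  \<open>fcalc\<close> of \<open>x * exp (x * of_real t)\<close>, which is the product of
  \<open>M\<close> and the exponential in either order. The commuted form serves the uniqueness of
  trajectories.\<close>

lemma mat_exp_derivative:
  assumes "i < n" "j < n"
  shows "((\<lambda>t. mat_exp (t \<cdot>\<^sub>m M) $$ (i, j)) has_real_derivative (M * mat_exp (t \<cdot>\<^sub>m M)) $$ (i, j))
      (at t within S)"
    and "(M * mat_exp (t \<cdot>\<^sub>m M)) $$ (i, j) = (mat_exp (t \<cdot>\<^sub>m M) * M) $$ (i, j)"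
proof -
  have E: "mat_exp (t \<cdot>\<^sub>m M) \<in> carrier_mat n n" "cmat (mat_exp (t \<cdot>\<^sub>m M)) = fcalc (\<lambda>x. exp (x * of_real t))" for t
    using propagator_carrier[of Continuous t] cmat_propagator[of Continuous t] by simp_all
  have prod: "cmat (M * mat_exp (t \<cdot>\<^sub>m M)) = fcalc (\<lambda>x. x * exp (x * of_real t))"
    "cmat (mat_exp (t \<cdot>\<^sub>m M) * M) = fcalc (\<lambda>x. x * exp (x * of_real t))"
    using E(1)[of t] M
    by (simp_all add: cmat_mult[of _ n n _ n] E(2) fcalc_id[symmetric] fcalc_mult mult.commute)
  then have "cmat (M * mat_exp (t \<cdot>\<^sub>m M)) = cmat (mat_exp (t \<cdot>\<^sub>m M) * M)"
    by simp
  then show "(M * mat_exp (t \<cdot>\<^sub>m M)) $$ (i, j) = (mat_exp (t \<cdot>\<^sub>m M) * M) $$ (i, j)"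
    using inj_cmat by force
  have "((\<lambda>s. exp (l k * complex_of_real s)) has_vector_derivative l k * exp (l k * of_real t)) (at t within S)" for k
    by (rule has_vector_derivative_real_field) (auto intro!: derivative_eq_intros)
  then have "((\<lambda>t. fcalc (\<lambda>x. exp (x * of_real t)) $$ (i, j)) has_vector_derivative
      fcalc (\<lambda>x. x * exp (x * of_real t)) $$ (i, j)) (at t within S)"
    using assms
    by (simp only: fcalc_index)
      (intro has_vector_derivative_sum has_vector_derivative_mult_right has_vector_derivative_mult_left)
  then have "((\<lambda>t. Re (fcalc (\<lambda>x. exp (x * of_real t)) $$ (i, j))) has_real_derivative
      Re (fcalc (\<lambda>x. x * exp (x * of_real t)) $$ (i, j))) (at t within S)"
    by (simp add: has_vector_derivative_complex_iff)
  moreover have "Re (fcalc (\<lambda>x. exp (x * of_real t)) $$ (i, j)) = mat_exp (t \<cdot>\<^sub>m M) $$ (i, j)" for t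
    using mat_exp_index[OF assms, of t] by (metis Re_complex_of_real)
  moreover have "Re (fcalc (\<lambda>x. x * exp (x * of_real t)) $$ (i, j)) = (M * mat_exp (t \<cdot>\<^sub>m M)) $$ (i, j)"
  proof -
    have "M * mat_exp (t \<cdot>\<^sub>m M) \<in> carrier_mat n n"
      using M E(1)[of t] by simp
    then show ?thesis
      using assms by (simp add: prod(1)[symmetric] del: index_mult_mat)
  qed
  ultimately show "((\<lambda>t. mat_exp (t \<cdot>\<^sub>m M) $$ (i, j)) has_real_derivative (M * mat_exp (t \<cdot>\<^sub>m M)) $$ (i, j))
      (at t within S)"
    by simp
qed

lemma trajectory_propagator:
  assumes x: "x \<in> carrier_vec n"
  shows "trajectory td M x (\<lambda>t. propagator td M t *\<^sub>v x)"
proof -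
  have "autonomous_dynamics td M (\<lambda>t. propagator td M t *\<^sub>v x)"
  proof (cases td)
    case Continuous
    have "((\<lambda>t. (mat_exp (t \<cdot>\<^sub>m M) *\<^sub>v x) $ i) has_real_derivative (M *\<^sub>v (mat_exp (t \<cdot>\<^sub>m M) *\<^sub>v x)) $ i)
        (at t within {0..})" if i: "i < n" for t i
    proof -
      have E: "mat_exp (t \<cdot>\<^sub>m M) \<in> carrier_mat n n" for t
        using propagator_carrier[of Continuous t] by simp
      have "((\<lambda>t. \<Sum>j<n. mat_exp (t \<cdot>\<^sub>m M) $$ (i, j) * x $ j) has_real_derivative
          (\<Sum>j<n. (M * mat_exp (t \<cdot>\<^sub>m M)) $$ (i, j) * x $ j)) (at t within {0..})"
        using i by (intro DERIV_sum DERIV_cmult_right mat_exp_derivative) auto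
      moreover have "(M *\<^sub>v (mat_exp (t \<cdot>\<^sub>m M) *\<^sub>v x)) $ i = (\<Sum>j<n. (M * mat_exp (t \<cdot>\<^sub>m M)) $$ (i, j) * x $ j)"
        using i x M E[of t] by (simp only: assoc_mult_mat_vec[of _ n n _ n, symmetric] mult_carrier_mat
            mult_mat_vec_index_sum[of _ n n])
      moreover have "(mat_exp (t \<cdot>\<^sub>m M) *\<^sub>v x) $ i = (\<Sum>j<n. mat_exp (t \<cdot>\<^sub>m M) $$ (i, j) * x $ j)" for t
        using i x E[of t] by (rule_tac mult_mat_vec_index_sum)
      ultimately show ?thesis
        by simp
    qed
    then show ?thesis
      using M by (simp add: Continuous)
  next
    case Discrete
    have "propagator td M (t + 1) *\<^sub>v x = M *\<^sub>v (propagator td M t *\<^sub>v x)" if "t \<in> \<nat>" for t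
    proof -
      have "t \<in> times td" "1 \<in> times td"
        using that Discrete by auto
      then have "propagator td M (t + 1) = M * propagator td M t"
        using M by (intro inj_cmat)
          (simp add: cmat_mult[of _ n n _ n] cmat_propagator mode_add fcalc_id[symmetric] fcalc_mult,
           simp add: Discrete mult.commute)
      then show ?thesis
        using M x by (simp add: assoc_mult_mat_vec[of _ n n _ n])
    qed
    then show ?thesis
      by (simp add: Discrete del: propagator.simps)
  qed
  moreover have "propagator td M t *\<^sub>v x \<in> carrier_vec n" for t
    using x propagator_carrier[of td t] by (metis mult_mat_vec_carrier)
  ultimately show ?thesis
    using M x by (simp add: trajectory_def propagator_0 del: propagator.simps)
qed

text \<open>In continuous time \<open>s \<mapsto> e\<^bsup>(t - s)M\<^esup> \<xi>(s)\<close> is constant on \<open>[0, t]\<close>.\<close>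

lemma trajectory_unique:
  assumes "trajectory td M x \<xi>" and t: "t \<in> times td"
  shows "\<xi> t = propagator td M t *\<^sub>v x"
proof (cases td)
  case Continuous
  let ?E = "\<lambda>t. mat_exp (t \<cdot>\<^sub>m M)"
  have E: "?E t \<in> carrier_mat n n" for t
    using propagator_carrier[of Continuous t] by simp
  have \<xi>: "\<xi> s \<in> carrier_vec n" if "s \<ge> 0" for s
    using assms M that by (auto simp: trajectory_def Continuous)
  have \<xi>0: "\<xi> 0 = x"
    using assms by (simp add: trajectory_def)
  have d\<xi>: "((\<lambda>s. \<xi> s $ j) has_real_derivative (M *\<^sub>v \<xi> s) $ j) (at s within {0..})"
    if "j < n" "s \<ge> 0" for s j
    using assms(1) M that by (simp add: trajectory_def Continuous)
  have t0: "t \<ge> 0"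
    using t by (rule times_nonneg)
  have "(\<xi> t) $ i = (?E t *\<^sub>v x) $ i" if i: "i < n" for i
  proof -
    define g where "g s = (\<Sum>j<n. ?E (t - s) $$ (i, j) * \<xi> s $ j)" for s
    have dg: "(g has_real_derivative 0) (at s within {0..})" if s: "s \<ge> 0" for s
    proof -
      have dE: "((\<lambda>s. ?E (t - s) $$ (i, j)) has_real_derivative - (?E (t - s) * M) $$ (i, j)) (at s within {0..})"
        if "j < n" for j
      proof -
        have "((\<lambda>s. ?E s $$ (i, j)) \<circ> (\<lambda>s. t - s) has_real_derivative
            (M * ?E (t - s)) $$ (i, j) * (- 1)) (at s within {0..})"
          by (rule DERIV_chain) (use i that in \<open>auto intro!: mat_exp_derivative derivative_eq_intros\<close>)
        then show ?thesis
          using mat_exp_derivative(2)[OF i that] by (simp add: o_def)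
      qed
      have "(g has_real_derivative (\<Sum>j<n. - (?E (t - s) * M) $$ (i, j) * \<xi> s $ j
          + (M *\<^sub>v \<xi> s) $ j * ?E (t - s) $$ (i, j))) (at s within {0..})"
        unfolding g_def using s by (intro DERIV_sum DERIV_mult dE d\<xi>) auto
      moreover have "(\<Sum>j<n. (?E (t - s) * M) $$ (i, j) * \<xi> s $ j) = (\<Sum>j<n. ?E (t - s) $$ (i, j) * (M *\<^sub>v \<xi> s) $ j)"
      proof -
        have "((?E (t - s) * M) *\<^sub>v \<xi> s) $ i = (?E (t - s) *\<^sub>v (M *\<^sub>v \<xi> s)) $ i"
          using E M \<xi>[OF s] by (simp only: assoc_mult_mat_vec[of _ n n _ n])
        then show ?thesis
          using E[of "t - s"] M \<xi>[OF s] i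
          by (simp only: mult_mat_vec_index_sum[of _ n n] mult_carrier_mat mult_mat_vec_carrier)
      qed
      ultimately show ?thesis
        by (simp add: sum_subtractf mult.commute)
    qed
    have "g t = g 0"
    \<comment> \<open>Constancy from a vanishing derivative is applied on \<open>{0..t}\<close>,
      which has to be a nondegenerate interval.\<close>
    proof (cases "t = 0")
      case False
      have "continuous_on {0..t} g"
        using dg by (meson DERIV_continuous atLeastAtMost_iff atLeast_iff continuous_on_eq_continuous_within
            continuous_on_subset subsetI)
      moreover have "(g has_real_derivative 0) (at s)" if "0 < s" "s < t" for s
        using dg[of s] that at_within_open_subset[of s "{0<..}" "{0..}"] by fastforce
      ultimately show ?thesis
        using False t0 by (intro DERIV_isconst_end) auto
    qed simp
    moreover have "g t = (1\<^sub>m n *\<^sub>v \<xi> t) $ i"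
      unfolding g_def using i \<xi>[OF t0] propagator_0[of Continuous]
      by (subst mult_mat_vec_index_sum[of _ n n]) auto
    moreover have "g 0 = (?E t *\<^sub>v x) $ i"
      unfolding g_def using i \<xi>[of 0] E[of t] \<xi>0 by (subst mult_mat_vec_index_sum[of _ n n]) auto
    ultimately show ?thesis
      using \<xi>[OF t0] by simp
  qed
  then show ?thesis
    using \<xi>[OF t0] E[of t] by (auto simp: Continuous)
next
  case Discrete
  have x: "x \<in> carrier_vec n"
    using assms(1) M by (auto simp: trajectory_def)
  have "\<xi> (of_nat k) = M ^\<^sub>m k *\<^sub>v x" for k
  proof (induction k)
    case 0
    then show ?case
      using assms(1) M x by (simp add: trajectory_def)
  next
    case (Suc k)
    have "\<xi> (of_nat k + 1) = M *\<^sub>v \<xi> (of_nat k)"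
      using assms(1) by (simp add: trajectory_def Discrete)
    \<comment> \<open>The recursion of the trajectory multiplies by \<open>M\<close> on the left,
      whereas the power unfolds to \<open>M ^\<^sub>m k * M\<close>.\<close>
    moreover have "M * M ^\<^sub>m k = M ^\<^sub>m Suc k"
      using M by (intro inj_cmat)
        (simp add: cmat_mult[of _ n n _ n] fcalc_pow fcalc_id[symmetric] fcalc_mult mult.commute)
    ultimately show ?case
      using M x by (simp add: Suc assoc_mult_mat_vec[of _ n n _ n, symmetric] add.commute)
  qed
  then show ?thesis
    using t by (auto simp: Discrete elim!: Nats_cases)
qed

end

subsection \<open>Existence of a decoupled eigenbasis\<close>

text \<open>The vectors mapped into the span of \<open>U\<close> form a subspace. The twist
  \<open>\<sigma>\<close> covers both applications: \<open>cnj\<close> for complex conjugation, the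
  identity for the linear map \<open>M - a I\<close>.\<close>

lemma (in vec_space) span_semilinear_image:
  assumes U: "U \<subseteq> carrier_vec n" and S: "S \<subseteq> carrier_vec n"
    and f_carrier: "\<And>x. x \<in> carrier_vec n \<Longrightarrow> f x \<in> carrier_vec n"
    and f_0: "f (0\<^sub>v n) = 0\<^sub>v n"
    and f_add: "\<And>x y. x \<in> carrier_vec n \<Longrightarrow> y \<in> carrier_vec n \<Longrightarrow> f (x + y) = f x + f y"
    and f_smult: "\<And>c x. x \<in> carrier_vec n \<Longrightarrow> f (c \<cdot>\<^sub>v x) = \<sigma> c \<cdot>\<^sub>v f x"
    and image: "\<And>u. u \<in> S \<Longrightarrow> f u \<in> span U"
    and x: "x \<in> span S"
  shows "f x \<in> span U"
proof -
  let ?N = "{x \<in> carrier_vec n. f x \<in> span U}"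
  have "submodule class_ring ?N V"
  proof (unfold_locales, goal_cases)
    case (2 v w)
    then show ?case
      using span_add1[OF U] by (auto simp: f_add)
  next
    case 3
    then show ?case
      using in_spanI[of "0\<^sub>v n" "\<lambda>_. 0" "{}" U] by (simp add: f_0 lincomb_def)
  next
    case (4 c v)
    then show ?case
      using smult_in_span[OF U] by (auto simp: f_smult)
  qed auto
  moreover have "S \<subseteq> ?N"
    using S image by auto
  ultimately show ?thesis
    using span_is_subset x by blast
qed

section \<open>Modal vectors and modal families\<close>

context diagonalized
begin

interpretation vs: vec_space "TYPE(complex)" n .

abbreviation eig :: "complex vec \<Rightarrow> complex \<Rightarrow> bool" where
  "eig x a \<equiv> x \<in> carrier_vec n \<and> cmat M *\<^sub>v x = a \<cdot>\<^sub>v x"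

text \<open>Visible vectors are normalized to have a unit vector as output. The coefficient of such
  a vector in a state is then also the coefficient of its mode in the output.\<close>

definition modal :: "real mat \<Rightarrow> complex vec \<Rightarrow> bool" where
  "modal H u \<longleftrightarrow> u \<noteq> 0\<^sub>v n \<and> (\<exists>a. eig u a) \<and>
     (cmat H *\<^sub>v u = 0\<^sub>v (dim_row H) \<or> (\<exists>i < dim_row H. cmat H *\<^sub>v u = unit_vec (dim_row H) i))"

text \<open>The last clause makes conjugation fix the vectors of real eigenvalues, so that real
  states have real coefficients there.\<close>

definition modal_family :: "real mat \<Rightarrow> complex vec set \<Rightarrow> bool" where
  "modal_family H U \<longleftrightarrow> U \<subseteq> carrier_vec n \<and> vs.lin_indpt U \<and>
     (\<forall>u \<in> U. modal H u \<and> conjugate u \<in> U \<and> (\<forall>a \<in> \<real>. eig u a \<longrightarrow> conjugate u = u))"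

lemma cmat_M_carrier [simp]: "cmat M \<in> carrier_mat n n"
  using M by simp

lemma eig_add: "eig x a \<Longrightarrow> eig y a \<Longrightarrow> eig (x + y) a"
  using M by (simp add: mult_add_distrib_mat_vec[of _ n n] smult_add_distrib_vec[of _ n])

lemma eig_smult: "eig x a \<Longrightarrow> eig (c \<cdot>\<^sub>v x) a"
  using M by (simp add: mult_mat_vec[of _ n n] smult_smult_assoc mult.commute)

lemma eig_minus: "eig x a \<Longrightarrow> eig y a \<Longrightarrow> eig (x - y) a"
  using M by (auto simp: mult_minus_distrib_mat_vec[of _ n n] algebra_simps intro!: eq_vecI)

lemma eig_conjugate: "eig x a \<Longrightarrow> eig (conjugate x) (cnj a)"
  using M by (simp add: conjugate_cmat_mult_vec[of _ n n] conjugate_smult_vec)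

lemma conjugate_unit_vec [simp]: "conjugate (unit_vec p i :: complex vec) = unit_vec p i"
  by (rule eq_vecI) (auto simp: unit_vec_def)

lemma modal_conjugate:
  assumes "H \<in> carrier_mat p n" "modal H u"
  shows "modal H (conjugate u)"
proof -
  have u: "u \<in> carrier_vec n"
    using assms(2) by (auto simp: modal_def)
  have "conjugate u \<noteq> 0\<^sub>v n"
    using assms(2) u by (auto simp: modal_def)
  moreover have "\<exists>a. eig (conjugate u) a"
    using assms(2) eig_conjugate by (auto simp: modal_def)
  ultimately show ?thesis
    using assms u by (auto simp: modal_def conjugate_cmat_mult_vec[of H p n])
qed

lemma eig_unique:
  assumes "eig u a" "eig u b" "u \<noteq> 0\<^sub>v n"
  shows "a = b"
proof -
  obtain i where i: "i < n" "u $ i \<noteq> 0"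
    using assms by (metis carrier_vecD eq_vecI index_zero_vec)
  have "a \<cdot>\<^sub>v u = b \<cdot>\<^sub>v u"
    using assms by simp
  then have "(a \<cdot>\<^sub>v u) $ i = (b \<cdot>\<^sub>v u) $ i"
    by simp
  then show ?thesis
    using i assms(1) by auto
qed

text \<open>The empty family qualifies, and linear independence bounds all cardinalities by
  \<open>n\<close>.\<close>

lemma maximal_family_exists:
  "\<exists>U. modal_family H U \<and> (\<forall>W. modal_family H W \<longrightarrow> card W \<le> card U)"
proof -
  have "card U \<le> n" if "modal_family H U" for U
    using that vs.li_le_dim[of U] by (auto simp: modal_family_def vs.dim_is_n)
  moreover have "vs.lin_indpt {}"
    by (auto simp: vs.lin_dep_def)
  then have "modal_family H {}"
    by (simp add: modal_family_def)
  ultimately show ?thesis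
    using ex_has_greatest_nat[of "modal_family H" "{}" card "Suc n"] by (auto simp: less_Suc_eq_le)
qed

section \<open>A modal family of largest cardinality\<close>

context
  fixes H :: "real mat" and p :: nat and U :: "complex vec set"
  assumes H: "H \<in> carrier_mat p n"
    and U: "modal_family H U"
    and maximal: "\<And>W. modal_family H W \<Longrightarrow> card W \<le> card U"
begin

lemma U_carrier: "U \<subseteq> carrier_vec n"
  and U_indpt: "vs.lin_indpt U"
  and U_modal: "u \<in> U \<Longrightarrow> modal H u"
  and U_conjugate: "u \<in> U \<Longrightarrow> conjugate u \<in> U"
  and U_real: "u \<in> U \<Longrightarrow> a \<in> \<real> \<Longrightarrow> eig u a \<Longrightarrow> conjugate u = u"
  using U by (auto simp: modal_family_def)

lemma finite_U: "finite U"
  using vs.li_le_dim[OF vs.fin_dim] U_carrier U_indpt by blast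

lemma span_U_carrier: "x \<in> vs.span U \<Longrightarrow> x \<in> carrier_vec n"
  using vs.span_is_subset2[OF U_carrier] by blast

lemma span_U_conjugate: "x \<in> vs.span U \<Longrightarrow> conjugate x \<in> vs.span U"
  by (rule vs.span_semilinear_image[where S = U and \<sigma> = cnj])
    (use U_carrier U_conjugate in \<open>auto simp: conjugate_add_vec conjugate_smult_vec intro: vs.span_mem\<close>)

lemma indpt_insert:
  assumes "W \<subseteq> carrier_vec n" "vs.lin_indpt W" "x \<in> carrier_vec n" "x \<notin> vs.span W"
  shows "vs.lin_indpt (insert x W)"
  using vs.lin_dep_iff_in_span[of W x] assms vs.in_own_span[of W] by auto

lemma zero_in_span: "0\<^sub>v n \<in> vs.span U"
  using vs.in_spanI[of "0\<^sub>v n" "\<lambda>_. 0" "{}" U] by (simp add: vs.lincomb_def)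

lemma not_in_span_card:
  assumes "modal_family H (insert x W)" "finite W" "x \<notin> W" "card U \<le> card W"
  shows False
  using maximal[OF assms(1)] assms by simp

text \<open>Otherwise \<open>x\<close>, being its own conjugate, could be adjoined to
  \<open>U\<close> on its own, contradicting maximality.\<close>

lemma modal_real_in_span:
  assumes x: "modal H x" "eig x a" "a \<in> \<real>" "conjugate x = x"
  shows "x \<in> vs.span U"
proof (rule ccontr)
  assume out: "x \<notin> vs.span U"
  then have "x \<notin> U"
    using vs.in_own_span[OF U_carrier] by auto
  moreover have "modal_family H (insert x U)"
    using U_carrier x U_modal U_conjugate U_real indpt_insert[OF U_carrier U_indpt _ out]
    by (auto simp: modal_family_def)
  ultimately show False
    using not_in_span_card[of x U] finite_U by simp
qed

text \<open>If \<open>conjugate x\<close> were a combination of \<open>x\<close> and \<open>U\<close>, applying \<open>M - a I\<close> would put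
  \<open>(cnj a - a) conjugate x\<close>, hence \<open>x\<close>, into the span of \<open>U\<close>.\<close>

lemma modal_nonreal_in_span:
  assumes x: "modal H x" "eig x a" "a \<notin> \<real>"
  shows "x \<in> vs.span U"
proof (rule ccontr)
  assume out: "x \<notin> vs.span U"
  have xc: "x \<in> carrier_vec n"
    using x by simp
  have xU: "x \<notin> U"
    using out vs.in_own_span[OF U_carrier] by auto
  have W: "insert x U \<subseteq> carrier_vec n"
    using xc U_carrier by auto
  have a: "cnj a - a \<noteq> 0"
    using x(3) Reals_cnj_iff by auto
  have conj_out: "conjugate x \<notin> vs.span (insert x U)"
  proof
    assume "conjugate x \<in> vs.span (insert x U)"
    then have "cmat M *\<^sub>v conjugate x - a \<cdot>\<^sub>v conjugate x \<in> vs.span U"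
    proof (rule vs.span_semilinear_image[where \<sigma> = "\<lambda>c. c", rotated -1])
      fix u
      assume u: "u \<in> insert x U"
      have in_U: "cmat M *\<^sub>v u - a \<cdot>\<^sub>v u \<in> vs.span U" if "eig u b" "u \<in> U" for b
      proof -
        have "cmat M *\<^sub>v u - a \<cdot>\<^sub>v u = (b - a) \<cdot>\<^sub>v u"
          using that by (auto simp: left_diff_distrib)
        then show ?thesis
          using vs.smult_in_span[OF U_carrier subsetD[OF vs.in_own_span[OF U_carrier] that(2)]] by simp
      qed
      show "cmat M *\<^sub>v u - a \<cdot>\<^sub>v u \<in> vs.span U"
      proof (cases "u \<in> U")
        case True
        then obtain b where "eig u b"
          using U_modal unfolding modal_def by blast
        then show ?thesis
          using in_U True by blast
      next
        case False
        then show ?thesis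
          using u x(2) zero_in_span by auto
      qed
    next
      fix y z :: "complex vec"
      assume yz: "y \<in> carrier_vec n" "z \<in> carrier_vec n"
      have [simp]: "cmat M *\<^sub>v y \<in> carrier_vec n" "cmat M *\<^sub>v z \<in> carrier_vec n"
        using yz by (auto intro: mult_mat_vec_carrier[OF cmat_M_carrier])
      show "cmat M *\<^sub>v (y + z) - a \<cdot>\<^sub>v (y + z)
          = cmat M *\<^sub>v y - a \<cdot>\<^sub>v y + (cmat M *\<^sub>v z - a \<cdot>\<^sub>v z)"
        unfolding mult_add_distrib_mat_vec[OF cmat_M_carrier yz]
        using yz M by (intro eq_vecI) (auto simp: distrib_left)
    next
      fix c and z :: "complex vec"
      assume z: "z \<in> carrier_vec n"
      then have [simp]: "cmat M *\<^sub>v z \<in> carrier_vec n"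
        by (rule mult_mat_vec_carrier[OF cmat_M_carrier])
      show "cmat M *\<^sub>v (c \<cdot>\<^sub>v z) - a \<cdot>\<^sub>v (c \<cdot>\<^sub>v z) = c \<cdot>\<^sub>v (cmat M *\<^sub>v z - a \<cdot>\<^sub>v z)"
        unfolding mult_mat_vec[OF cmat_M_carrier z]
        using z M by (intro eq_vecI) (auto simp: right_diff_distrib)
    next
      show "cmat M *\<^sub>v 0\<^sub>v n - a \<cdot>\<^sub>v 0\<^sub>v n = 0\<^sub>v n"
        using M by (intro eq_vecI) auto
    qed (use U_carrier W M in simp_all)
    moreover have "cmat M *\<^sub>v conjugate x - a \<cdot>\<^sub>v conjugate x = (cnj a - a) \<cdot>\<^sub>v conjugate x"
      using eig_conjugate[OF x(2)] by (auto simp: left_diff_distrib)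
    ultimately have "(cnj a - a) \<cdot>\<^sub>v conjugate x \<in> vs.span U"
      by simp
    then have "inverse (cnj a - a) \<cdot>\<^sub>v ((cnj a - a) \<cdot>\<^sub>v conjugate x) \<in> vs.span U"
      by (rule vs.smult_in_span[OF U_carrier])
    then have "conjugate x \<in> vs.span U"
      using a by (simp add: smult_smult_assoc)
    then show False
      using span_U_conjugate out by force
  qed
  \<comment> \<open>The clause of \<open>modal_family\<close> about real eigenvalues is thus vacuous
    for both new vectors.\<close>
  have real: "b \<notin> \<real>" if "eig x b \<or> eig (conjugate x) b" for b
  proof -
    have "b = a \<or> b = cnj a"
      using eig_unique[OF _ x(2)] eig_unique[OF _ eig_conjugate[OF x(2)]] that x(1)
        modal_conjugate[OF H x(1)] by (auto simp: modal_def)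
    then show ?thesis
      using x(3) Reals_cnj_iff complex_cnj_cnj by metis
  qed
  have "vs.lin_indpt (insert (conjugate x) (insert x U))"
    using indpt_insert[OF W] indpt_insert[OF U_carrier U_indpt xc out] conj_out xc by simp
  then have "modal_family H (insert (conjugate x) (insert x U))"
    using U_carrier x U_modal U_conjugate U_real modal_conjugate[OF H x(1)] real xc
    by (auto simp: modal_family_def)
  moreover have "conjugate x \<notin> insert x U"
    using conj_out vs.in_own_span[OF W] by auto
  ultimately show False
    using not_in_span_card[of "conjugate x" "insert x U"] finite_U xU by simp
qed

text \<open>For a real eigenvalue, the real part \<open>r\<close> and the imaginary part
  \<open>s\<close> of \<open>x\<close> lie in the same eigenspace. The output of \<open>x\<close> is
  zero or a unit vector, hence real: \<open>r\<close> inherits it and \<open>s\<close> is mapped to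
  zero. So each part is modal or zero, and \<open>x = r + \<i> \<cdot>\<^sub>v s\<close>.\<close>

lemma modal_in_span:
  assumes x: "modal H x \<or> x = 0\<^sub>v n"
  shows "x \<in> vs.span U"
proof (cases "x = 0\<^sub>v n")
  case True
  then show ?thesis
    using zero_in_span by simp
next
  case False
  then have mod: "modal H x"
    using x by auto
  then obtain a where a: "eig x a"
    by (auto simp: modal_def)
  show ?thesis
  proof (cases "a \<in> \<real>")
    case real: True
    define r where "r = (1/2) \<cdot>\<^sub>v (x + conjugate x)"
    define s where "s = (-\<i>/2) \<cdot>\<^sub>v (x - conjugate x)"
    have xc: "x \<in> carrier_vec n"
      using a by simp
    have eig_c: "eig (conjugate x) a"
      using eig_conjugate[OF a] real by (simp add: Reals_cnj_iff)
    have eigs: "eig r a" "eig s a"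
      unfolding r_def s_def by (rule eig_smult eig_add eig_minus a eig_c)+
    have conj: "conjugate r = r" "conjugate s = s"
      using xc by (auto simp: r_def s_def intro!: eq_vecI simp: algebra_simps)
    have Hc: "cmat H *\<^sub>v conjugate x = cmat H *\<^sub>v x"
      using mod H xc by (auto simp: modal_def conjugate_cmat_mult_vec[of H p n])
    have Hx: "cmat H *\<^sub>v x \<in> carrier_vec p"
      using H xc by simp
    have "cmat H *\<^sub>v r = cmat H *\<^sub>v x"
      using xc H Hx by (auto simp: r_def mult_mat_vec[of _ p n] mult_add_distrib_mat_vec[of _ p n] Hc
          intro!: eq_vecI)
    then have "modal H r \<or> r = 0\<^sub>v n"
      using eigs mod by (auto simp: modal_def)
    moreover have "cmat H *\<^sub>v s = 0\<^sub>v p"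
      using xc H Hx by (auto simp: s_def mult_mat_vec[of _ p n] mult_minus_distrib_mat_vec[of _ p n] Hc
          intro!: eq_vecI)
    then have "modal H s \<or> s = 0\<^sub>v n"
      using eigs H by (auto simp: modal_def)
    ultimately have "r \<in> vs.span U" "s \<in> vs.span U"
      using modal_real_in_span[OF _ _ real] eigs conj zero_in_span by metis+
    then have "r + \<i> \<cdot>\<^sub>v s \<in> vs.span U"
      using vs.span_add1[OF U_carrier] vs.smult_in_span[OF U_carrier] by simp
    moreover have "r + \<i> \<cdot>\<^sub>v s = x"
      using xc by (auto simp: r_def s_def intro!: eq_vecI simp: algebra_simps)
    ultimately show ?thesis
      by simp
  qed (use modal_nonreal_in_span mod a in blast)
qed

section \<open>Spanning when every eigenspace decouples\<close>

context
  assumes decouple: "\<And>x a i. eig x a \<Longrightarrow> i < p \<Longrightarrow>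
    \<exists>y. eig y a \<and> cmat H *\<^sub>v y = (cmat H *\<^sub>v x) $ i \<cdot>\<^sub>v unit_vec p i"
begin

text \<open>The output of \<open>x\<close> is reproduced one component at a time by vectors of the
  same eigenspace that lie in the span. The remainder \<open>x - w\<close> is annihilated by
  \<open>H\<close>, so it is modal or zero.\<close>

lemma eig_in_span:
  assumes x: "eig x a"
  shows "x \<in> vs.span U"
proof -
  have "\<exists>w \<in> vs.span U. eig w a \<and> cmat H *\<^sub>v w = vec p (\<lambda>i. if i < k then (cmat H *\<^sub>v x) $ i else 0)" if "k \<le> p" for k
    using that
  proof (induction k)
    case 0
    have "cmat H *\<^sub>v 0\<^sub>v n = 0\<^sub>v p" "cmat M *\<^sub>v 0\<^sub>v n = 0\<^sub>v n"
      using H M by auto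
    moreover have "vec p (\<lambda>i. if i < 0 then (cmat H *\<^sub>v x) $ i else 0) = 0\<^sub>v p"
      by auto
    ultimately show ?case
      using zero_in_span by (intro bexI[of _ "0\<^sub>v n"]) auto
  next
    case (Suc k)
    then obtain w where w: "w \<in> vs.span U" "eig w a"
      and Hw: "cmat H *\<^sub>v w = vec p (\<lambda>i. if i < k then (cmat H *\<^sub>v x) $ i else 0)"
      by auto
    define c where "c = (cmat H *\<^sub>v x) $ k"
    obtain y where y: "eig y a" and Hy: "cmat H *\<^sub>v y = c \<cdot>\<^sub>v unit_vec p k"
      using decouple[OF x, of k] Suc.prems by (auto simp: c_def)
    have "y \<in> vs.span U"
    \<comment> \<open>If \<open>c\<close> vanishes, \<open>y\<close> is annihilated by
      \<open>H\<close>; otherwise division by \<open>c\<close> normalizes its output to a unit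
      vector.\<close>
    proof (cases "c = 0")
      case True
      then have "modal H y \<or> y = 0\<^sub>v n"
        using y Hy H by (auto simp: modal_def)
      then show ?thesis
        by (rule modal_in_span)
    next
      case False
      have "cmat H *\<^sub>v (inverse c \<cdot>\<^sub>v y) = unit_vec p k"
        using H y False by (simp add: mult_mat_vec[of _ p n] Hy smult_smult_assoc)
      then have "modal H (inverse c \<cdot>\<^sub>v y) \<or> inverse c \<cdot>\<^sub>v y = 0\<^sub>v n"
        using eig_smult[OF y, of "inverse c"] H Suc.prems unfolding modal_def by auto
      then have "c \<cdot>\<^sub>v (inverse c \<cdot>\<^sub>v y) \<in> vs.span U"
        by (rule vs.smult_in_span[OF U_carrier modal_in_span])
      then show ?thesis
        using False by (simp add: smult_smult_assoc)
    qed
    then have "w + y \<in> vs.span U"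
      using vs.span_add1[OF U_carrier] w by simp
    moreover have "cmat H *\<^sub>v (w + y) = vec p (\<lambda>i. if i < Suc k then (cmat H *\<^sub>v x) $ i else 0)"
      using H w y Suc.prems
      by (auto simp: mult_add_distrib_mat_vec[of _ p n] Hw Hy c_def less_Suc_eq intro!: eq_vecI)
    ultimately show ?case
      using eig_add[OF w(2) y] by blast
  qed
  from this[of p] obtain w where w: "w \<in> vs.span U" "eig w a"
    and "cmat H *\<^sub>v w = vec p (\<lambda>i. if i < p then (cmat H *\<^sub>v x) $ i else 0)"
    by auto
  then have Hw: "cmat H *\<^sub>v w = cmat H *\<^sub>v x"
    using H by (auto intro!: eq_vecI)
  have "cmat H *\<^sub>v (x - w) = cmat H *\<^sub>v x - cmat H *\<^sub>v x"
    using H x w by (simp add: mult_minus_distrib_mat_vec[of _ p n] Hw)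
  also have "\<dots> = 0\<^sub>v p"
    using H x by (intro minus_cancel_vec mult_mat_vec_carrier[of _ p n]) auto
  finally have "modal H (x - w) \<or> x - w = 0\<^sub>v n"
    using eig_minus[OF x w(2)] H by (auto simp: modal_def)
  then have "x - w + w \<in> vs.span U"
    using vs.span_add1[OF U_carrier] w modal_in_span by blast
  moreover have "x - w + w = x"
    using x w by auto
  ultimately show ?thesis
    by simp
qed

text \<open>The columns of \<open>P\<close> are eigenvectors, and they span the space because
  \<open>P\<close> is invertible.\<close>

lemma span_U: "vs.span U = carrier_vec n"
proof
  show "vs.span U \<subseteq> carrier_vec n"
    using span_U_carrier by auto
next
  have "col P k \<in> vs.span U" if k: "k < n" for k
  proof (rule eig_in_span)
    have "cmat M * P = P * mat_diag n l"
    proof -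
      have "cmat M * P = P * mat_diag n l * (Q * P)"
        using P Q by (simp add: M_eq assoc_mult_mat[of _ n n _ n _ n] mult_carrier_mat[of _ n n])
      then show ?thesis
        using P by (simp add: QP right_mult_one_mat[of _ n n] mult_carrier_mat[of _ n n])
    qed
    then have "cmat M *\<^sub>v col P k = col (P * mat_diag n l) k"
      using col_mult2[of "cmat M" n n P n k] M P k by simp
    also have "\<dots> = l k \<cdot>\<^sub>v col P k"
      using P k by (auto simp: mat_diag_mult_right[OF P] intro!: eq_vecI)
    finally show "eig (col P k) (l k)"
      using P k by simp
  qed
  then have "set (cols P) \<subseteq> vs.span U"
    using P by (auto simp: cols_def)
  then have "vs.col_space P \<subseteq> vs.span U"
    unfolding vs.col_space_def using vs.span_subsetI[OF U_carrier] by simp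
  moreover have "x \<in> vs.col_space P" if x: "x \<in> carrier_vec n" for x
  proof -
    have "P *\<^sub>v (Q *\<^sub>v x) = x"
      using P Q x PQ by (simp add: assoc_mult_mat_vec[of _ n n _ n, symmetric])
    then show ?thesis
      using P Q x by (subst vs.col_space_eq[of _ n]) (auto intro!: bexI[of _ "Q *\<^sub>v x"])
  qed
  ultimately show "carrier_vec n \<subseteq> vs.span U"
    by auto
qed

text \<open>The maximal family is sorted by output and enumerated within each class. Unit outputs,
  the involution property of \<open>\<kappa>\<close> and its fixing of real modes are recorded as
  well, so that the coefficients of a real state can be chosen admissible and read off from the
  outputs.\<close>

lemma decoupled_eigenbasis_exists:
  "\<exists>\<nu> \<Lambda> \<kappa> v. decoupled_eigenbasis M H \<nu> \<Lambda> \<kappa> v \<and>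
     (\<forall>i < p. \<forall>j < \<nu> (Suc i). cmat H *\<^sub>v v (Suc i) j = unit_vec p i) \<and>
     (\<forall>i \<le> p. \<forall>j < \<nu> i. \<kappa> i (\<kappa> i j) = j \<and> (\<Lambda> i j \<in> \<real> \<longrightarrow> \<kappa> i j = j))"
proof -
  define V where "V i = (case i of 0 \<Rightarrow> {u \<in> U. cmat H *\<^sub>v u = 0\<^sub>v p}
    | Suc i \<Rightarrow> {u \<in> U. cmat H *\<^sub>v u = unit_vec p i})" for i
  define \<nu> where "\<nu> i = card (V i)" for i
  have V_U: "V i \<subseteq> U" for i
    by (auto simp: V_def split: nat.splits)
  then have "finite (V i)" for i
    using finite_U finite_subset by blast
  then have "\<exists>h. bij_betw h {..<\<nu> i} (V i)" for i
    using ex_bij_betw_nat_finite[of "V i"] by (auto simp: \<nu>_def lessThan_atLeast0)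
  then obtain v where v: "bij_betw (v i) {..<\<nu> i} (V i)" for i
    by metis
  \<comment> \<open>Conjugation permutes each \<open>V i\<close>, since zero and the unit vectors
    are real; \<open>\<kappa>\<close> is this permutation on indices.\<close>
  define \<kappa> where "\<kappa> i j = inv_into {..<\<nu> i} (v i) (conjugate (v i j))" for i j
  have vV: "v i j \<in> V i" if "j < \<nu> i" for i j
    using v[of i] that by (auto simp: bij_betw_def)
  then have vU: "v i j \<in> U" if "j < \<nu> i" for i j
    using V_U that by blast
  \<comment> \<open>A nonzero vector belongs to at most one eigenvalue, so the choice is
    determined.\<close>
  define \<Lambda> where "\<Lambda> i j = (SOME a. eig (v i j) a)" for i j
  have \<Lambda>: "eig (v i j) (\<Lambda> i j)" if "j < \<nu> i" for i j
  proof -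
    have "\<exists>a. eig (v i j) a"
      using U_modal[OF vU[OF that]] by (simp add: modal_def)
    then show ?thesis
      unfolding \<Lambda>_def by (rule someI_ex)
  qed
  have nz: "v i j \<noteq> 0\<^sub>v n" if "j < \<nu> i" for i j
    using U_modal[OF vU[OF that]] by (auto simp: modal_def)
  have conj_V: "conjugate u \<in> V i" if "u \<in> V i" for u i
  proof -
    have "cmat H *\<^sub>v conjugate u = conjugate (cmat H *\<^sub>v u)"
      using U_carrier V_U that H by (intro conjugate_cmat_mult_vec) auto
    then show ?thesis
      using that U_conjugate by (auto simp: V_def split: nat.splits)
  qed
  have \<kappa>: "\<kappa> i j < \<nu> i" "v i (\<kappa> i j) = conjugate (v i j)" if "j < \<nu> i" for i j
  proof -
    have *: "conjugate (v i j) \<in> v i ` {..<\<nu> i}"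
      using conj_V[OF vV[OF that]] v[of i] by (simp add: bij_betw_def)
    show "\<kappa> i j < \<nu> i" "v i (\<kappa> i j) = conjugate (v i j)"
      unfolding \<kappa>_def using inv_into_into[OF *] f_inv_into_f[OF *] by auto
  qed
  have v_inj: "j = k" if "v i j = v i k" "j < \<nu> i" "k < \<nu> i" for i j k
    using v[of i] that by (auto simp: bij_betw_def inj_on_def)
  have \<kappa>\<kappa>: "\<kappa> i (\<kappa> i j) = j" if "j < \<nu> i" for i j
    using that \<kappa>[OF that] \<kappa>[OF \<kappa>(1)[OF that]] by (intro v_inj) auto
  have \<kappa>_real: "\<kappa> i j = j" if "j < \<nu> i" "\<Lambda> i j \<in> \<real>" for i j
    using that \<kappa>[OF that(1)] U_real[OF vU[OF that(1)] that(2) \<Lambda>[OF that(1)]] by (intro v_inj) auto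
  have \<Lambda>\<kappa>: "\<Lambda> i (\<kappa> i j) = cnj (\<Lambda> i j)" if "j < \<nu> i" for i j
    using \<Lambda>[OF \<kappa>(1)[OF that]] eig_conjugate[OF \<Lambda>[OF that]] nz[OF \<kappa>(1)[OF that]] \<kappa>(2)[OF that]
    by (intro eig_unique[of "v i (\<kappa> i j)"]) auto
  \<comment> \<open>The classes are told apart by their outputs; this makes the enumeration of all
    of \<open>U\<close> injective.\<close>
  have disjoint: "i = k" if "u \<in> V i" "u \<in> V k" "i \<le> p" "k \<le> p" for u i k
  proof -
    have unit: "unit_vec p a = (unit_vec p b :: complex vec) \<longleftrightarrow> a = b" if "a < p" "b < p" for a b
      using that by (auto simp: unit_vec_eq)
    have unit_0: "unit_vec p a \<noteq> (0\<^sub>v p :: complex vec)" if "a < p" for a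
      using that by (metis index_unit_vec(1) index_zero_vec(1) zero_neq_one)
    show ?thesis
      using that unit unit_0 unit_0[symmetric] by (cases i; cases k) (auto simp: V_def)
  qed
  have image: "(\<lambda>(i, j). v i j) ` mode_index p \<nu> = U"
  proof
    show "(\<lambda>(i, j). v i j) ` mode_index p \<nu> \<subseteq> U"
      using vU by (auto simp: mode_index_def)
  next
    show "U \<subseteq> (\<lambda>(i, j). v i j) ` mode_index p \<nu>"
    proof
      fix u assume u: "u \<in> U"
      then obtain i where i: "i \<le> p" "u \<in> V i"
      proof (cases "cmat H *\<^sub>v u = 0\<^sub>v p")
        case True
        then show ?thesis
          using that[of 0] u by (auto simp: V_def)
      next
        case False
        then obtain i where "i < p" "cmat H *\<^sub>v u = unit_vec p i"
          using U_modal[OF u] H by (auto simp: modal_def)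
        then show ?thesis
          using that[of "Suc i"] u by (auto simp: V_def)
      qed
      then have "u \<in> v i ` {..<\<nu> i}"
        using v[of i] by (simp add: bij_betw_def)
      then obtain j where "j < \<nu> i" "v i j = u"
        by auto
      then show "u \<in> (\<lambda>(i, j). v i j) ` mode_index p \<nu>"
        using i by (force simp: mode_index_def)
    qed
  qed
  have inj: "inj_on (\<lambda>(i, j). v i j) (mode_index p \<nu>)"
  proof (rule inj_onI, clarify)
    fix i j i' j'
    assume "(i, j) \<in> mode_index p \<nu>" "(i', j') \<in> mode_index p \<nu>" and eq: "v i j = v i' j'"
    then have b: "i \<le> p" "j < \<nu> i" "i' \<le> p" "j' < \<nu> i'"
      by (auto simp: mode_index_def)
    then have "i = i'"
      using disjoint[of "v i j"] vV eq by metis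
    then show "i = i' \<and> j = j'"
      using v_inj eq b by simp
  qed
  have basis: "vs.basis U"
    using U_carrier U_indpt span_U by (simp add: vs.basis_def)
  have out: "cmat H *\<^sub>v v (Suc i) j = unit_vec p i" if "j < \<nu> (Suc i)" for i j
    using vV[OF that] by (simp add: V_def)
  have dims: "dim_row M = n" "dim_row H = p"
    using M H by auto
  have "decoupled_eigenbasis M H \<nu> \<Lambda> \<kappa> v"
    unfolding decoupled_eigenbasis_def Let_def dims image
  proof (intro conjI)
    show "\<forall>(i, j) \<in> mode_index p \<nu>. eigenvector (cmat M) (v i j) (\<Lambda> i j)"
      using \<Lambda> nz dims by (auto simp: mode_index_def eigenvector_def)
    show "\<forall>(i, j) \<in> mode_index p \<nu>. \<kappa> i j < \<nu> i \<and> v i (\<kappa> i j) = conjugate (v i j) \<and> \<Lambda> i (\<kappa> i j) = cnj (\<Lambda> i j)"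
      using \<kappa> \<Lambda>\<kappa> by (simp add: mode_index_def)
    show "\<forall>j < \<nu> 0. cmat H *\<^sub>v v 0 j = 0\<^sub>v p"
      using vV[of _ 0] by (simp add: V_def)
    show "\<forall>i < p. \<forall>j < \<nu> (Suc i). \<exists>c. c \<noteq> 0 \<and> cmat H *\<^sub>v v (Suc i) j = c \<cdot>\<^sub>v unit_vec p i"
      using out by (intro allI impI exI[of _ 1]) simp
  qed (use inj basis in simp_all)
  then show ?thesis
    using \<kappa>\<kappa> \<kappa>_real out by blast
qed

end
end
end

context diagonalized
begin

interpretation vs: vec_space "TYPE(complex)" n .

subsection \<open>Decoupling of the eigenspaces\<close>

lemma fcalc_smult: "fcalc (\<lambda>x. c * f x) = c \<cdot>\<^sub>m fcalc f"
proof (rule eq_matI)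
  fix i j assume "i < dim_row (c \<cdot>\<^sub>m fcalc f)" "j < dim_col (c \<cdot>\<^sub>m fcalc f)"
  then have "i < n" "j < n"
    using fcalc_carrier[of f] by (auto simp del: fcalc_carrier)
  then show "fcalc (\<lambda>x. c * f x) $$ (i, j) = (c \<cdot>\<^sub>m fcalc f) $$ (i, j)"
    using fcalc_carrier[of f]
    by (simp add: fcalc_index sum_distrib_left algebra_simps del: fcalc_carrier)
qed (use fcalc_carrier[of f] fcalc_carrier[of "\<lambda>x. c * f x"] in \<open>auto simp del: fcalc_carrier\<close>)

text \<open>The indicator of \<open>b\<close> yields the spectral projection onto the eigenspace of
  \<open>b\<close>. Grouping equal \<open>l k\<close> writes a response as a combination of modes
  with distinct exponents, as comparison of coefficients requires. Points of \<open>S\<close>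
  outside the spectrum contribute zero.\<close>

lemma fcalc_projections:
  assumes A: "A \<in> carrier_mat p n" and y: "y \<in> carrier_vec n" and r: "r < p"
    and S: "finite S" "l ` {..<n} \<subseteq> S"
  shows "(A *\<^sub>v (fcalc f *\<^sub>v y)) $ r
    = (\<Sum>b\<in>S. (A *\<^sub>v (fcalc (\<lambda>x. if x = b then 1 else 0) *\<^sub>v y)) $ r * f b)"
proof -
  define d where "d k = (A * P) $$ (r, k) * (Q *\<^sub>v y) $ k" for k
  have d: "(A *\<^sub>v (fcalc g *\<^sub>v y)) $ r = (\<Sum>k<n. d k * g (l k))" for g
  proof -
    let ?D = "mat_diag n (\<lambda>k. g (l k))"
    have "A *\<^sub>v (fcalc g *\<^sub>v y) = ((A * P) * ?D) *\<^sub>v (Q *\<^sub>v y)"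
      using A P Q y
      by (simp add: fcalc_def assoc_mult_mat_vec[of _ n n _ n] assoc_mult_mat_vec[of _ p n _ n]
          mult_carrier_mat[of _ n n] mult_carrier_mat[of _ p n] mult_mat_vec_carrier[of _ n n])
    also have "\<dots> $ r = (\<Sum>k<n. ((A * P) * ?D) $$ (r, k) * (Q *\<^sub>v y) $ k)"
      using A P Q y r by (intro mult_mat_vec_index_sum[OF mult_carrier_mat[OF _ mat_diag_dim]]) auto
    also have "(A * P) * ?D = mat p n (\<lambda>(i, k). (A * P) $$ (i, k) * g (l k))"
      using A P by (intro mat_diag_mult_right) auto
    finally show ?thesis
      using r by (simp add: d_def algebra_simps)
  qed
  have "(\<Sum>b\<in>S. (\<Sum>k<n. d k * (if l k = b then 1 else 0)) * f b)
      = (\<Sum>k<n. \<Sum>b\<in>S. if l k = b then d k * f b else 0)"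
    unfolding sum_distrib_right by (subst sum.swap) (auto intro!: sum.cong)
  also have "\<dots> = (\<Sum>k<n. d k * f (l k))"
    using S by (intro sum.cong) auto
  finally show ?thesis
    by (simp add: d)
qed

text \<open>The state \<open>y\<close> whose response is the isolated output \<open>i\<close> of
  \<open>x\<close> may have components in several eigenspaces. Independence of the modes shows that
  its projection onto the eigenspace of \<open>a\<close> alone has the required output.\<close>

lemma eigenspace_decouple:
  assumes H: "H \<in> carrier_mat p n"
    and resp: "\<And>x i. x \<in> carrier_vec n \<Longrightarrow> i < p \<Longrightarrow>
      \<exists>y \<in> carrier_vec n. \<forall>t \<in> times td.
        (H * propagator td M t) *\<^sub>v y = ((H * propagator td M t) *\<^sub>v x) $ i \<cdot>\<^sub>v unit_vec p i"
    and x: "x \<in> carrier_vec n" "cmat M *\<^sub>v x = a \<cdot>\<^sub>v x" and i: "i < p"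
  shows "\<exists>y. (y \<in> carrier_vec n \<and> cmat M *\<^sub>v y = a \<cdot>\<^sub>v y) \<and>
    cmat H *\<^sub>v y = (cmat H *\<^sub>v x) $ i \<cdot>\<^sub>v unit_vec p i"
proof -
  define h where "h = (cmat H *\<^sub>v x) $ i"
  let ?W = "\<lambda>t. H * propagator td M t"
  let ?R = "map_vec Re x" and ?I = "map_vec Im x"
  have W: "?W t \<in> carrier_mat p n" for t
    using H propagator_carrier[of td t] by simp
  have cW: "cmat (?W t) *\<^sub>v z = cmat H *\<^sub>v (fcalc (\<lambda>b. mode td b t) *\<^sub>v z)" if "z \<in> carrier_vec n" for z t
    using H that propagator_carrier[of td t]
    by (simp add: cmat_mult[of H p n _ n] cmat_propagator assoc_mult_mat_vec[of _ p n _ n] del: propagator_carrier)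
  \<comment> \<open>The hypothesis concerns real states, so it is applied to the real and the
    imaginary part of \<open>x\<close>, and the two results are reassembled into
    \<open>y\<close>.\<close>
  obtain yr where yr: "yr \<in> carrier_vec n"
      "\<And>t. t \<in> times td \<Longrightarrow> ?W t *\<^sub>v yr = (?W t *\<^sub>v ?R) $ i \<cdot>\<^sub>v unit_vec p i"
    using resp[of ?R i] x i by auto
  obtain yi where yi: "yi \<in> carrier_vec n"
      "\<And>t. t \<in> times td \<Longrightarrow> ?W t *\<^sub>v yi = (?W t *\<^sub>v ?I) $ i \<cdot>\<^sub>v unit_vec p i"
    using resp[of ?I i] x i by auto
  define y where "y = vec n (\<lambda>k. Complex (yr $ k) (yi $ k))"
  have y: "y \<in> carrier_vec n"
    by (simp add: y_def)
  have split: "(cmat A *\<^sub>v z) $ r = Complex ((A *\<^sub>v map_vec Re z) $ r) ((A *\<^sub>v map_vec Im z) $ r)"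
    if "A \<in> carrier_mat p n" "z \<in> carrier_vec n" "r < p" for A z r
    using that by (subst (1 2 3) mult_mat_vec_index_sum[of _ p n]) (auto simp: complex_eq_iff)
  have y_parts: "map_vec Re y = yr" "map_vec Im y = yi"
    using yr yi by (auto simp: y_def intro!: eq_vecI)
  have Wx: "(cmat (?W t) *\<^sub>v x) $ i = mode td a t * h" for t
    using cW[OF x(1)] fcalc_eigenvector[OF x, of "\<lambda>b. mode td b t"] H x i
    by (simp add: mult_mat_vec[of _ p n] h_def)
  have Wy: "(cmat (?W t) *\<^sub>v y) $ r = (if r = i then mode td a t * h else 0)"
    if "t \<in> times td" "r < p" for t r
  proof -
    have "(cmat (?W t) *\<^sub>v y) $ r = Complex ((?W t *\<^sub>v yr) $ r) ((?W t *\<^sub>v yi) $ r)"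
      using split[OF W y that(2)] by (simp add: y_parts)
    also have "\<dots> = (if r = i then Complex ((?W t *\<^sub>v ?R) $ i) ((?W t *\<^sub>v ?I) $ i) else 0)"
      using that i by (simp add: yr(2) yi(2) complex_eq_iff)
    finally show ?thesis
      using split[OF W x(1) i] Wx by simp
  qed
  \<comment> \<open>As \<open>x\<close> may be zero, \<open>a\<close> need not occur among the
    \<open>l k\<close>; inserting it allows coefficients to be compared at \<open>a\<close> in every
    case.\<close>
  define S where "S = insert a (l ` {..<n})"
  define \<pi> where "\<pi> b = fcalc (\<lambda>x. if x = b then 1 else 0) *\<^sub>v y" for b
  have S: "finite S" "l ` {..<n} \<subseteq> S" "a \<in> S"
    by (auto simp: S_def)
  have \<pi>: "\<pi> b \<in> carrier_vec n" for b
    using y by (auto simp: \<pi>_def intro!: mult_mat_vec_carrier)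
  have H\<pi>: "(cmat H *\<^sub>v \<pi> a) $ r = (if r = i then h else 0)" if r: "r < p" for r
  proof -
    \<comment> \<open>The coefficient of the mode \<open>b\<close> in the difference between
      component \<open>r\<close> of the response of \<open>y\<close> and its prescribed
      value.\<close>
    let ?c = "\<lambda>b. (cmat H *\<^sub>v \<pi> b) $ r - (if b = a \<and> r = i then h else 0)"
    have "(\<Sum>b\<in>S. ?c b * mode td b t) = 0" if t: "t \<in> times td" for t
    proof -
      have "(\<Sum>b\<in>S. ?c b * mode td b t) = (\<Sum>b\<in>S. (cmat H *\<^sub>v \<pi> b) $ r * mode td b t)
          - (\<Sum>b\<in>S. if b = a then (if r = i then h * mode td a t else 0) else 0)"
        unfolding sum_subtractf[symmetric] by (intro sum.cong) (auto simp: algebra_simps)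
      also have "(\<Sum>b\<in>S. (cmat H *\<^sub>v \<pi> b) $ r * mode td b t) = (cmat (?W t) *\<^sub>v y) $ r"
        unfolding \<pi>_def cW[OF y] using H y r S by (intro fcalc_projections[symmetric]) auto
      also have "(\<Sum>b\<in>S. if b = a then (if r = i then h * mode td a t else 0) else 0)
          = (if r = i then h * mode td a t else 0)"
        using S by simp
      finally show ?thesis
        using Wy[OF t r] by simp
    qed
    from modes_independent[OF S(1) this S(3)] show ?thesis
      by simp
  qed
  have "cmat M *\<^sub>v \<pi> a = (fcalc (\<lambda>x. x) * fcalc (\<lambda>x. if x = a then 1 else 0)) *\<^sub>v y"
    using y by (simp add: \<pi>_def fcalc_id[symmetric] assoc_mult_mat_vec[of _ n n _ n])
  \<comment> \<open>The functions agree because the indicator vanishes away from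
    \<open>a\<close>.\<close>
  also have "fcalc (\<lambda>x. x) * fcalc (\<lambda>x. if x = a then 1 else 0) = fcalc (\<lambda>x. a * (if x = a then 1 else 0))"
    unfolding fcalc_mult by (intro arg_cong[of _ _ fcalc]) auto
  also have "\<dots> *\<^sub>v y = a \<cdot>\<^sub>v \<pi> a"
    using y fcalc_carrier[of "\<lambda>x. if x = a then 1 else 0"] unfolding \<pi>_def fcalc_smult
    by (intro eq_vecI) (auto simp: scalar_prod_def sum_distrib_left algebra_simps simp del: fcalc_carrier)
  finally have "cmat M *\<^sub>v \<pi> a = a \<cdot>\<^sub>v \<pi> a" .
  moreover have "cmat H *\<^sub>v \<pi> a = h \<cdot>\<^sub>v unit_vec p i"
    using H H\<pi> i by (intro eq_vecI) auto
  ultimately show ?thesis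
    using \<pi> by (auto simp: h_def)
qed

subsection \<open>Responses in a decoupled eigenbasis\<close>

context
  fixes H :: "real mat" and p :: nat and \<nu> :: "nat \<Rightarrow> nat" and \<Lambda> :: "nat \<Rightarrow> nat \<Rightarrow> complex"
    and \<kappa> :: "nat \<Rightarrow> nat \<Rightarrow> nat" and v :: "nat \<Rightarrow> nat \<Rightarrow> complex vec"
  assumes H: "H \<in> carrier_mat p n" and basis: "decoupled_eigenbasis M H \<nu> \<Lambda> \<kappa> v"
begin

text \<open>Coefficients are attached to index pairs rather than to vectors, so that they can be
  mixed between outputs and permuted by \<open>\<kappa>\<close>.\<close>

definition comb :: "(nat \<Rightarrow> nat \<Rightarrow> complex) \<Rightarrow> complex vec" where
  "comb \<alpha> = vec n (\<lambda>r. \<Sum>i\<le>p. \<Sum>j<\<nu> i. \<alpha> i j * v i j $ r)"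

lemma comb_carrier [simp]: "comb \<alpha> \<in> carrier_vec n"
  by (simp add: comb_def)

lemma basis_eigenvector:
  assumes "i \<le> p" "j < \<nu> i"
  shows "v i j \<in> carrier_vec n" "cmat M *\<^sub>v v i j = \<Lambda> i j \<cdot>\<^sub>v v i j"
  using basis M H assms
  by (auto simp: decoupled_eigenbasis_def Let_def mode_index_def eigenvector_def)

lemma basis_conjugate:
  assumes "i \<le> p" "j < \<nu> i"
  shows "\<kappa> i j < \<nu> i" "v i (\<kappa> i j) = conjugate (v i j)" "\<Lambda> i (\<kappa> i j) = cnj (\<Lambda> i j)"
  using basis M H assms by (auto simp: decoupled_eigenbasis_def Let_def mode_index_def)

lemma basis_output:
  assumes "i \<le> p" "j < \<nu> i" "k < p" "i \<noteq> Suc k"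
  shows "(cmat H *\<^sub>v v i j) $ k = 0"
proof (cases i)
  case 0
  then show ?thesis
    using basis H assms by (auto simp: decoupled_eigenbasis_def Let_def)
next
  case (Suc i')
  have "\<forall>i < p. \<forall>j < \<nu> (Suc i). \<exists>c. c \<noteq> 0 \<and> cmat H *\<^sub>v v (Suc i) j = c \<cdot>\<^sub>v unit_vec p i"
    using basis H by (simp add: decoupled_eigenbasis_def Let_def)
  then obtain c where "cmat H *\<^sub>v v (Suc i') j = c \<cdot>\<^sub>v unit_vec p i'"
    using Suc assms by (meson Suc_le_lessD)
  then show ?thesis
    using Suc assms by auto
qed

lemma comb_surj:
  assumes x: "x \<in> carrier_vec n"
  obtains \<alpha> where "x = comb \<alpha>"
proof -
  let ?I = "mode_index p \<nu>" and ?v = "\<lambda>(i, j). v i j"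
  have fin: "finite ?I"
    by (simp add: mode_index_def)
  have inj: "inj_on ?v ?I" and b: "vs.basis (?v ` ?I)"
    using basis M H by (auto simp: decoupled_eigenbasis_def Let_def)
  have U: "?v ` ?I \<subseteq> carrier_vec n"
    using basis_eigenvector by (auto simp: mode_index_def)
  have "x \<in> vs.span (?v ` ?I)"
    using b x by (simp add: vs.basis_def)
  then obtain c where c: "x = vs.lincomb c (?v ` ?I)"
    using vs.finite_span[OF finite_imageI[OF fin] U] by auto
  have "x = comb (\<lambda>i j. c (v i j))"
  proof (rule eq_vecI)
    fix r assume "r < dim_vec (comb (\<lambda>i j. c (v i j)))"
    then have r: "r < n"
      by (simp add: comb_def)
    have "x $ r = (\<Sum>u\<in>?v ` ?I. c u * u $ r)"
      unfolding c by (rule vs.lincomb_index[OF r U])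
    also have "\<dots> = (\<Sum>(i, j)\<in>?I. c (v i j) * v i j $ r)"
      by (subst sum.reindex[OF inj]) (simp add: case_prod_unfold)
    also have "\<dots> = (\<Sum>i\<le>p. \<Sum>j<\<nu> i. c (v i j) * v i j $ r)"
      unfolding mode_index_def by (subst sum.Sigma[symmetric]) auto
    finally show "x $ r = comb (\<lambda>i j. c (v i j)) $ r"
      using r by (simp add: comb_def)
  qed (use x in \<open>simp add: comb_def\<close>)
  then show ?thesis
    by (rule that)
qed

lemma mult_comb:
  assumes W: "W \<in> carrier_mat q n" and k: "k < q"
  shows "(W *\<^sub>v comb \<alpha>) $ k = (\<Sum>i\<le>p. \<Sum>j<\<nu> i. \<alpha> i j * (W *\<^sub>v v i j) $ k)"
proof -
  have "(W *\<^sub>v comb \<alpha>) $ k = (\<Sum>r<n. \<Sum>i\<le>p. \<Sum>j<\<nu> i. W $$ (k, r) * (\<alpha> i j * v i j $ r))"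
    by (subst mult_mat_vec_index_sum[OF W comb_carrier k])
      (simp add: comb_def sum_distrib_left)
  also have "\<dots> = (\<Sum>i\<le>p. \<Sum>r<n. \<Sum>j<\<nu> i. W $$ (k, r) * (\<alpha> i j * v i j $ r))"
    by (rule sum.swap)
  also have "\<dots> = (\<Sum>i\<le>p. \<Sum>j<\<nu> i. \<Sum>r<n. W $$ (k, r) * (\<alpha> i j * v i j $ r))"
    by (intro sum.cong sum.swap refl)
  also have "\<dots> = (\<Sum>i\<le>p. \<Sum>j<\<nu> i. \<alpha> i j * (W *\<^sub>v v i j) $ k)"
    using basis_eigenvector
    by (intro sum.cong refl) (auto simp: mult_mat_vec_index_sum[OF W _ k] sum_distrib_left algebra_simps)
  finally show ?thesis .
qed

text \<open>The propagator multiplies each basis vector by its own mode, and component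
  \<open>k\<close> of the output vanishes on all basis vectors whose first index is not
  \<open>Suc k\<close>.\<close>

lemma comb_response:
  assumes k: "k < p"
  shows "(cmat (H * propagator td M t) *\<^sub>v comb \<alpha>) $ k =
    (\<Sum>j<\<nu> (Suc k). \<alpha> (Suc k) j * (cmat H *\<^sub>v v (Suc k) j) $ k * mode td (\<Lambda> (Suc k) j) t)"
proof -
  let ?W = "cmat (H * propagator td M t)"
  have W: "?W \<in> carrier_mat p n"
    using H propagator_carrier[of td t] by simp
  have Wv: "(?W *\<^sub>v v i j) $ k = mode td (\<Lambda> i j) t * (cmat H *\<^sub>v v i j) $ k" if "i \<le> p" "j < \<nu> i" for i j
  proof -
    have "?W *\<^sub>v v i j = cmat H *\<^sub>v (cmat (propagator td M t) *\<^sub>v v i j)"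
      using H basis_eigenvector(1)[OF that] propagator_carrier[of td t]
      by (simp add: cmat_mult[of H p n _ n] assoc_mult_mat_vec[of _ p n _ n] del: propagator_carrier)
    also have "cmat (propagator td M t) *\<^sub>v v i j = mode td (\<Lambda> i j) t \<cdot>\<^sub>v v i j"
      by (rule propagator_eigenvector[OF basis_eigenvector[OF that]])
    finally show ?thesis
      using H basis_eigenvector(1)[OF that] k by (simp add: mult_mat_vec[of _ p n])
  qed
  have "(?W *\<^sub>v comb \<alpha>) $ k = (\<Sum>i\<le>p. \<Sum>j<\<nu> i. \<alpha> i j * (?W *\<^sub>v v i j) $ k)"
    by (rule mult_comb[OF W k])
  also have "\<dots> = (\<Sum>i\<in>{Suc k}. \<Sum>j<\<nu> i. \<alpha> i j * (?W *\<^sub>v v i j) $ k)"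
    using k by (intro sum.mono_neutral_right) (auto simp: Wv basis_output intro!: sum.neutral)
  finally show ?thesis
    using k by (simp add: Wv mult_ac)
qed

text \<open>Output \<open>i\<close> depends only on the coefficients with first index
  \<open>Suc i\<close>, so these may be taken from a different state for each output.\<close>

lemma independent_outputs:
  assumes xs: "\<And>i. i < p \<Longrightarrow> xs i \<in> carrier_vec n"
  obtains x0 where "x0 \<in> carrier_vec n"
    and "\<And>t i. i < p \<Longrightarrow> ((H * propagator td M t) *\<^sub>v x0) $ i = ((H * propagator td M t) *\<^sub>v xs i) $ i"
proof -
  have "\<forall>i. \<exists>\<alpha>. i < p \<longrightarrow> cvec (xs i) = comb \<alpha>"
    using comb_surj xs by (metis map_carrier_vec)
  then obtain \<alpha> where \<alpha>: "cvec (xs i) = comb (\<alpha> i)" if "i < p" for i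
    by metis
  \<comment> \<open>The shift by one matches the modes of index \<open>Suc i\<close> with the state
    \<open>xs i\<close>. At index 0 the truncated subtraction selects \<open>\<alpha> 0\<close>, but
    those modes do not reach the output.\<close>
  define x0 where "x0 = map_vec Re (comb (\<lambda>i j. \<alpha> (i - 1) i j))"
  have "((H * propagator td M t) *\<^sub>v x0) $ i = ((H * propagator td M t) *\<^sub>v xs i) $ i" if i: "i < p" for t i
  proof -
    have W: "H * propagator td M t \<in> carrier_mat p n"
      using H propagator_carrier[of td t] by simp
    have "((H * propagator td M t) *\<^sub>v x0) $ i
        = Re ((cmat (H * propagator td M t) *\<^sub>v comb (\<lambda>i j. \<alpha> (i - 1) i j)) $ i)"
      unfolding x0_def by (rule Re_cmat_mult_vec[OF W comb_carrier i])
    also have "\<dots> = Re ((cmat (H * propagator td M t) *\<^sub>v cvec (xs i)) $ i)"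
      by (simp add: \<alpha>[OF i] comb_response[OF i] del: propagator.simps)
    also have "\<dots> = ((H * propagator td M t) *\<^sub>v xs i) $ i"
      using W xs[OF i] i by (subst cmat_mult_vec[OF W xs[OF i], symmetric]) auto
    finally show ?thesis .
  qed
  then show ?thesis
    by (intro that[of x0]) (auto simp: x0_def)
qed

section \<open>Real responses and admissible coefficients\<close>

context
  assumes unit_outputs: "\<And>i j. i < p \<Longrightarrow> j < \<nu> (Suc i) \<Longrightarrow> cmat H *\<^sub>v v (Suc i) j = unit_vec p i"
    and \<kappa>_involution: "\<And>i j. i \<le> p \<Longrightarrow> j < \<nu> i \<Longrightarrow> \<kappa> i (\<kappa> i j) = j"
    and \<kappa>_real: "\<And>i j. i \<le> p \<Longrightarrow> j < \<nu> i \<Longrightarrow> \<Lambda> i j \<in> \<real> \<Longrightarrow> \<kappa> i j = j"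
begin

lemma sum_\<kappa>:
  "i \<le> p \<Longrightarrow> (\<Sum>j<\<nu> i. f (\<kappa> i j)) = (\<Sum>j<\<nu> i. f j)"
  by (rule sum.reindex_bij_witness[where i = "\<kappa> i" and j = "\<kappa> i"])
    (auto simp: \<kappa>_involution basis_conjugate)

text \<open>By uniqueness, every trajectory is given by the propagator, so the modal form has to be
  checked only there.\<close>

lemma modal_errorI:
  assumes x: "x \<in> carrier_vec n" and traj: "trajectory td M x \<xi>"
    and resp: "\<And>t i. t \<in> times td \<Longrightarrow> i < p \<Longrightarrow>
      complex_of_real (((H * propagator td M t) *\<^sub>v x) $ i) = (\<Sum>j<\<nu> (Suc i). \<beta> (Suc i) j * mode td (\<Lambda> (Suc i) j) t)"
  shows "modal_error td H \<nu> \<Lambda> \<beta> \<xi>"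
proof -
  have "H *\<^sub>v \<xi> t = (H * propagator td M t) *\<^sub>v x" if "t \<in> times td" for t
    using trajectory_unique[OF traj that] H x propagator_carrier[of td t]
    by (simp add: assoc_mult_mat_vec[of _ p n _ n] del: propagator_carrier)
  then show ?thesis
    using resp H by (simp add: modal_error_def)
qed

text \<open>A real state equals its conjugate, whose coefficients are
  \<open>cnj (\<alpha> i (\<kappa> i j))\<close>. Averaging them with \<open>\<alpha>\<close>
  represents the same state and is symmetric under \<open>\<kappa>\<close>; where
  \<open>\<kappa>\<close> fixes a mode, the average is real.\<close>

lemma modal_expansion:
  assumes x: "x \<in> carrier_vec n" and traj: "trajectory td M x \<xi>"
  shows "\<exists>\<beta>. admissible_coefficients p \<nu> \<Lambda> \<kappa> \<beta> \<and> modal_error td H \<nu> \<Lambda> \<beta> \<xi>"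
proof -
  obtain \<alpha> where \<alpha>: "cvec x = comb \<alpha>"
    using comb_surj x by (metis map_carrier_vec)
  define \<beta> where "\<beta> i j = (\<alpha> i j + cnj (\<alpha> i (\<kappa> i j))) / 2" for i j
  have "cvec x = comb \<beta>"
  proof (rule eq_vecI)
    fix r assume "r < dim_vec (comb \<beta>)"
    then have r: "r < n"
      by (simp add: comb_def)
    have e: "complex_of_real (x $ r) = (\<Sum>i\<le>p. \<Sum>j<\<nu> i. \<alpha> i j * v i j $ r)"
      using arg_cong[OF \<alpha>, of "\<lambda>z. z $ r"] x r by (simp add: comb_def)
    then have "cnj (complex_of_real (x $ r)) = (\<Sum>i\<le>p. \<Sum>j<\<nu> i. cnj (\<alpha> i j) * cnj (v i j $ r))"
      by (simp del: complex_cnj_complex_of_real)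
    also have "\<dots> = (\<Sum>i\<le>p. \<Sum>j<\<nu> i. cnj (\<alpha> i (\<kappa> i j)) * cnj (v i (\<kappa> i j) $ r))"
      by (intro sum.cong sum_\<kappa>[symmetric] refl) auto
    also have "\<dots> = (\<Sum>i\<le>p. \<Sum>j<\<nu> i. cnj (\<alpha> i (\<kappa> i j)) * v i j $ r)"
    proof (intro sum.cong refl)
      fix i j assume "i \<in> {..p}" "j \<in> {..<\<nu> i}"
      then show "cnj (\<alpha> i (\<kappa> i j)) * cnj (v i (\<kappa> i j) $ r) = cnj (\<alpha> i (\<kappa> i j)) * v i j $ r"
        using basis_conjugate(2)[of i j] basis_eigenvector(1)[of i j] r by simp
    qed
    finally have c: "cnj (complex_of_real (x $ r)) = (\<Sum>i\<le>p. \<Sum>j<\<nu> i. cnj (\<alpha> i (\<kappa> i j)) * v i j $ r)" .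
    have "2 * \<beta> i j * v i j $ r = \<alpha> i j * v i j $ r + cnj (\<alpha> i (\<kappa> i j)) * v i j $ r" for i j
      by (simp add: \<beta>_def distrib_right)
    then have "(\<Sum>i\<le>p. \<Sum>j<\<nu> i. 2 * \<beta> i j * v i j $ r) = (\<Sum>i\<le>p. \<Sum>j<\<nu> i. \<alpha> i j * v i j $ r)
        + (\<Sum>i\<le>p. \<Sum>j<\<nu> i. cnj (\<alpha> i (\<kappa> i j)) * v i j $ r)"
      by (simp only: sum.distrib)
    also have "\<dots> = 2 * complex_of_real (x $ r)"
      unfolding e[symmetric] c[symmetric] by simp
    finally have "2 * complex_of_real (x $ r) = (\<Sum>i\<le>p. \<Sum>j<\<nu> i. 2 * \<beta> i j * v i j $ r)" ..
    also have "\<dots> = 2 * comb \<beta> $ r"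
      using r by (simp add: comb_def sum_distrib_left mult.assoc)
    finally show "cvec x $ r = comb \<beta> $ r"
      using x r by simp
  qed (use x in \<open>simp add: comb_def\<close>)
  have "modal_error td H \<nu> \<Lambda> \<beta> \<xi>"
  proof (rule modal_errorI[OF x traj])
    fix t i assume i: "i < p"
    have W: "H * propagator td M t \<in> carrier_mat p n"
      using H propagator_carrier[of td t] by simp
    have "complex_of_real (((H * propagator td M t) *\<^sub>v x) $ i) = (cmat (H * propagator td M t) *\<^sub>v comb \<beta>) $ i"
      using cmat_mult_vec[OF W x] W x i \<open>cvec x = comb \<beta>\<close>
      by (metis carrier_matD(1) dim_mult_mat_vec index_map_vec(1))
    then show "complex_of_real (((H * propagator td M t) *\<^sub>v x) $ i) = (\<Sum>j<\<nu> (Suc i). \<beta> (Suc i) j * mode td (\<Lambda> (Suc i) j) t)"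
      using i by (simp add: comb_response unit_outputs del: propagator.simps)
  qed
  moreover have "admissible_coefficients p \<nu> \<Lambda> \<kappa> \<beta>"
    using \<kappa>_involution \<kappa>_real by (auto simp: admissible_coefficients_def \<beta>_def complex_is_Real_iff add.commute)
  ultimately show ?thesis
    by blast
qed

text \<open>Admissibility makes each output sum invariant under conjugation, since
  \<open>\<kappa>\<close> merely permutes its terms. The sums are therefore real and survive passing
  to the real part of the state.\<close>

lemma modal_realization:
  assumes \<beta>: "admissible_coefficients p \<nu> \<Lambda> \<kappa> \<beta>"
  shows "\<exists>x \<in> carrier_vec n. \<exists>\<xi>. trajectory td M x \<xi> \<and> modal_error td H \<nu> \<Lambda> \<beta> \<xi>"
proof -
  \<comment> \<open>The unobservable coefficients \<open>\<beta> 0 j\<close> are unconstrained, so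
    \<open>comb \<beta>\<close> itself need not be real.\<close>
  define x where "x = map_vec Re (comb \<beta>)"
  have x: "x \<in> carrier_vec n"
    by (simp add: x_def)
  have "modal_error td H \<nu> \<Lambda> \<beta> (\<lambda>t. propagator td M t *\<^sub>v x)"
  proof (rule modal_errorI[OF x trajectory_propagator[OF x]])
    fix t i assume i: "i < p"
    let ?s = "\<Sum>j<\<nu> (Suc i). \<beta> (Suc i) j * mode td (\<Lambda> (Suc i) j) t"
    have W: "H * propagator td M t \<in> carrier_mat p n"
      using H propagator_carrier[of td t] by simp
    have "\<beta> (Suc i) (\<kappa> (Suc i) j) = cnj (\<beta> (Suc i) j)" if "j < \<nu> (Suc i)" for j
    proof (cases "\<Lambda> (Suc i) j \<in> \<real>")
      case True
      then have "\<beta> (Suc i) j \<in> \<real>"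
        using \<beta> that i by (auto simp: admissible_coefficients_def)
      then show ?thesis
        using \<kappa>_real[of "Suc i" j] that i True by (simp add: Reals_cnj_iff)
    qed (use \<beta> that i in \<open>auto simp: admissible_coefficients_def\<close>)
    then have "cnj ?s = (\<Sum>j<\<nu> (Suc i). \<beta> (Suc i) (\<kappa> (Suc i) j) * mode td (\<Lambda> (Suc i) (\<kappa> (Suc i) j)) t)"
      using i basis_conjugate(3) by (simp add: mode_cnj)
    also have "\<dots> = ?s"
      using i by (intro sum_\<kappa>) simp
    finally have "?s \<in> \<real>"
      by (simp only: Reals_cnj_iff)
    moreover have "((H * propagator td M t) *\<^sub>v x) $ i = Re ?s"
      unfolding x_def Re_cmat_mult_vec[OF W comb_carrier i]
      using i by (simp add: comb_response unit_outputs del: propagator.simps)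
    ultimately show "complex_of_real (((H * propagator td M t) *\<^sub>v x) $ i) = ?s"
      by (simp only: of_real_Re)
  qed
  then show ?thesis
    using x trajectory_propagator[OF x] by blast
qed

end
end
end

subsection \<open>The characterization\<close>

lemma diagonalizable_imp_diagonalized:
  assumes M: "M \<in> carrier_mat n n" and "diagonalizable_over_complex M"
  obtains P Q l where "diagonalized n M P Q l"
proof -
  obtain L P Q where L: "diagonal_mat L" and "similar_mat_wit (cmat M) L P Q"
    using assms(2) by (auto simp: diagonalizable_over_complex_def similar_mat_def)
  note w = similar_mat_witD2[OF map_carrier_mat[THEN iffD2, OF M] this(2)]
  have "L = mat_diag n (\<lambda>i. L $$ (i, i))"
    using L w(5) by (intro eq_matI) (auto simp: mat_diag_def diagonal_mat_def)
  then have "diagonalized n M P Q (\<lambda>i. L $$ (i, i))"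
    using M w by unfold_locales auto
  then show ?thesis
    by (rule that)
qed

lemma mult_mat_row_index:
  assumes "H \<in> carrier_mat p n" "X \<in> carrier_mat n n" "x \<in> carrier_vec n" "i < p"
  shows "((mat_of_row (row H i) * X) *\<^sub>v x) $ 0 = ((H * X) *\<^sub>v x) $ i"
proof -
  have "mat_of_row (row H i) \<in> carrier_mat 1 n"
    using assms by auto
  then have "((mat_of_row (row H i) * X) *\<^sub>v x) $ 0 = row (mat_of_row (row H i)) 0 \<bullet> (X *\<^sub>v x)"
    using assms by (subst assoc_mult_mat_vec[of _ 1 n _ n]) auto
  then show ?thesis
    using assms by (subst assoc_mult_mat_vec[of _ p n _ n]) auto
qed

lemma zero_response:
  assumes "Ci \<in> carrier_mat 1 k" "Ai \<in> carrier_mat k k"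
  shows "((Ci * propagator td Ai t) *\<^sub>v 0\<^sub>v k) $ 0 = (0 :: real)"
proof -
  \<comment> \<open>The realization \<open>Ai\<close> is an arbitrary square matrix, so the
    dimensions come from the definition of the propagator and not from a diagonalization.\<close>
  have "propagator td Ai t \<in> carrier_mat k k"
    using assms(2) by (cases td) (auto simp: mat_exp_def)
  then have "(Ci * propagator td Ai t) *\<^sub>v 0\<^sub>v k = 0\<^sub>v 1"
    using assms(1) by (intro eq_vecI) (auto simp: scalar_prod_def)
  then show ?thesis
    by simp
qed

theorem theorem1:
  fixes td :: time_domain
    and n m p :: nat
    and A B C D F :: "real mat"
  assumes "A \<in> carrier_mat n n" and "B \<in> carrier_mat n m"
    and "C \<in> carrier_mat p n" and "D \<in> carrier_mat p m"
    and "right_invertible A B C D"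
    and "stabilizable td A B"
    and "\<not> invariant_zero A B C D (dc_point td)"
    and "F \<in> carrier_mat m n"
    and "stabilizing td A B F"
    and "diagonalizable_over_complex (A + B * F)"
  shows "state_to_output_decoupling td A B C D F \<longleftrightarrow>
    (\<exists>(ns :: nat \<Rightarrow> nat) (As :: nat \<Rightarrow> real mat) (Cs :: nat \<Rightarrow> real mat).
       (\<forall>i < p. As i \<in> carrier_mat (ns i) (ns i) \<and> Cs i \<in> carrier_mat 1 (ns i)) \<and>
       (\<forall>x0 \<in> carrier_vec n. \<exists>xs. (\<forall>i < p. xs i \<in> carrier_vec (ns i)) \<and>
          decoupled_response td A B C D F As Cs x0 xs) \<and>
       (\<forall>xs. (\<forall>i < p. xs i \<in> carrier_vec (ns i)) \<longrightarrow>
          (\<exists>x0 \<in> carrier_vec n. decoupled_response td A B C D F As Cs x0 xs)))"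
proof -
  let ?M = "A + B * F" and ?H = "C + D * F"
  let ?\<Phi> = "\<lambda>t. propagator td ?M t"
  have M: "?M \<in> carrier_mat n n" and H: "?H \<in> carrier_mat p n"
    using assms(1-4,8) by auto
  have dims: "dim_row ?M = n" "dim_row ?H = p" "dim_row C = p"
    using M H assms(3) by auto
  obtain P Q l where "diagonalized n ?M P Q l"
    using diagonalizable_imp_diagonalized[OF M assms(10)] .
  then interpret diagonalized n ?M P Q l .
  have H\<Phi>: "?H * ?\<Phi> t \<in> carrier_mat p n" for t
    using H propagator_carrier[of td t] by (rule mult_carrier_mat)
  show ?thesis
  proof (rule iffI, goal_cases)
    case 1
    then obtain \<nu> \<Lambda> \<kappa> v where basis: "decoupled_eigenbasis ?M ?H \<nu> \<Lambda> \<kappa> v"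
      unfolding state_to_output_decoupling_def Let_def by blast
    define Cs where "Cs i = mat_of_row (row ?H i)" for i
    have Cs: "Cs i \<in> carrier_mat 1 n" if "i < p" for i
      using H that by (auto simp: Cs_def)
    have resp: "decoupled_response td A B C D F (\<lambda>_. ?M) Cs x0 xs \<longleftrightarrow>
        (\<forall>t \<in> times td. \<forall>i < p. ((?H * ?\<Phi> t) *\<^sub>v x0) $ i = ((?H * ?\<Phi> t) *\<^sub>v xs i) $ i)"
      if "\<forall>i < p. xs i \<in> carrier_vec n" for x0 xs
    proof -
      have "((Cs i * ?\<Phi> t) *\<^sub>v xs i) $ 0 = ((?H * ?\<Phi> t) *\<^sub>v xs i) $ i" if "i < p" for i t
        unfolding Cs_def using H propagator_carrier \<open>\<forall>i < p. xs i \<in> carrier_vec n\<close> that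
        by (intro mult_mat_row_index) auto
      then show ?thesis
        using H\<Phi> assms(4) unfolding decoupled_response_def dims
        by (auto simp: vec_eq_iff simp del: propagator.simps)
    qed
    show ?case
    proof (rule exI[of _ "\<lambda>_. n"], rule exI[of _ "\<lambda>_. ?M"], rule exI[of _ Cs],
        intro conjI allI impI ballI)
      fix x0 :: "real vec"
      assume "x0 \<in> carrier_vec n"
      then show "\<exists>xs. (\<forall>i < p. xs i \<in> carrier_vec n) \<and> decoupled_response td A B C D F (\<lambda>_. ?M) Cs x0 xs"
        \<comment> \<open>The state itself serves as initial state of every realization.\<close>
        using resp[of "\<lambda>_. x0" x0] by (intro exI[of _ "\<lambda>_. x0"]) auto
    next
      fix xs :: "nat \<Rightarrow> real vec"
      assume xs: "\<forall>i < p. xs i \<in> carrier_vec n"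
      obtain x0 where "x0 \<in> carrier_vec n"
        "\<And>t i. i < p \<Longrightarrow> ((?H * ?\<Phi> t) *\<^sub>v x0) $ i = ((?H * ?\<Phi> t) *\<^sub>v xs i) $ i"
        using independent_outputs[OF H basis, of xs td] xs by blast
      then show "\<exists>x0 \<in> carrier_vec n. decoupled_response td A B C D F (\<lambda>_. ?M) Cs x0 xs"
        using resp[OF xs] by blast
    qed (use Cs M in auto)
  next
    case 2
    then obtain ns As Cs where
      AC: "\<And>i. i < p \<Longrightarrow> As i \<in> carrier_mat (ns i) (ns i) \<and> Cs i \<in> carrier_mat 1 (ns i)"
      and analysis: "\<And>x0. x0 \<in> carrier_vec n \<Longrightarrow> \<exists>xs. (\<forall>i < p. xs i \<in> carrier_vec (ns i)) \<and>
          decoupled_response td A B C D F As Cs x0 xs"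
      and synthesis: "\<And>xs. \<forall>i < p. xs i \<in> carrier_vec (ns i) \<Longrightarrow>
          \<exists>x0 \<in> carrier_vec n. decoupled_response td A B C D F As Cs x0 xs"
      by metis
    have resp: "\<exists>y \<in> carrier_vec n. \<forall>t \<in> times td.
        (?H * ?\<Phi> t) *\<^sub>v y = ((?H * ?\<Phi> t) *\<^sub>v x) $ i \<cdot>\<^sub>v unit_vec p i"
      if x: "x \<in> carrier_vec n" and i: "i < p" for x i
    proof -
      obtain xs where xs: "\<And>i. i < p \<Longrightarrow> xs i \<in> carrier_vec (ns i)"
        and x_resp: "decoupled_response td A B C D F As Cs x xs"
        using analysis[OF x] by blast
      \<comment> \<open>A zero initial state silences its output, so only the output
        \<open>i\<close> of \<open>x\<close> remains.\<close>
      define ys where "ys k = (if k = i then xs i else 0\<^sub>v (ns k))" for k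
      have "\<forall>k < p. ys k \<in> carrier_vec (ns k)"
        using xs by (simp add: ys_def)
      then obtain y where y: "y \<in> carrier_vec n" and y_resp: "decoupled_response td A B C D F As Cs y ys"
        using synthesis[of ys] by blast
      have "(?H * ?\<Phi> t) *\<^sub>v y = ((?H * ?\<Phi> t) *\<^sub>v x) $ i \<cdot>\<^sub>v unit_vec p i" if t: "t \<in> times td" for t
      proof (rule eq_vecI)
        fix k assume "k < dim_vec (((?H * ?\<Phi> t) *\<^sub>v x) $ i \<cdot>\<^sub>v unit_vec p i)"
        then have k: "k < p"
          by simp
        have "((?H * ?\<Phi> t) *\<^sub>v y) $ k = ((Cs k * propagator td (As k) t) *\<^sub>v ys k) $ 0"
          using y_resp t k by (simp add: decoupled_response_def dims del: propagator.simps)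
        also have "\<dots> = (if k = i then ((?H * ?\<Phi> t) *\<^sub>v x) $ i else 0)"
          using x_resp t i AC[OF k] zero_response[of "Cs k" "ns k" "As k" td t]
          by (simp add: decoupled_response_def dims ys_def del: propagator.simps)
        finally show "((?H * ?\<Phi> t) *\<^sub>v y) $ k = (((?H * ?\<Phi> t) *\<^sub>v x) $ i \<cdot>\<^sub>v unit_vec p i) $ k"
          using k i by simp
      qed (use assms(4) in simp)
      then show ?thesis
        using y by blast
    qed
    obtain U where U: "modal_family ?H U" "\<And>W. modal_family ?H W \<Longrightarrow> card W \<le> card U"
      using maximal_family_exists[of ?H] by auto
    have decouple: "\<exists>y. (y \<in> carrier_vec n \<and> cmat ?M *\<^sub>v y = a \<cdot>\<^sub>v y) \<and>
        cmat ?H *\<^sub>v y = (cmat ?H *\<^sub>v x) $ i \<cdot>\<^sub>v unit_vec p i"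
      if x: "x \<in> carrier_vec n \<and> cmat ?M *\<^sub>v x = a \<cdot>\<^sub>v x" and i: "i < p" for x a i
      using H resp x[THEN conjunct1] x[THEN conjunct2] i by (rule eigenspace_decouple)
    have "\<exists>\<nu> \<Lambda> \<kappa> v. decoupled_eigenbasis ?M ?H \<nu> \<Lambda> \<kappa> v \<and>
        (\<forall>i < p. \<forall>j < \<nu> (Suc i). cmat ?H *\<^sub>v v (Suc i) j = unit_vec p i) \<and>
        (\<forall>i \<le> p. \<forall>j < \<nu> i. \<kappa> i (\<kappa> i j) = j \<and> (\<Lambda> i j \<in> \<real> \<longrightarrow> \<kappa> i j = j))"
      using H U decouple by (rule decoupled_eigenbasis_exists)
    then obtain \<nu> \<Lambda> \<kappa> v where basis: "decoupled_eigenbasis ?M ?H \<nu> \<Lambda> \<kappa> v"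
      and unit: "\<forall>i < p. \<forall>j < \<nu> (Suc i). cmat ?H *\<^sub>v v (Suc i) j = unit_vec p i"
      and \<kappa>: "\<forall>i \<le> p. \<forall>j < \<nu> i. \<kappa> i (\<kappa> i j) = j \<and> (\<Lambda> i j \<in> \<real> \<longrightarrow> \<kappa> i j = j)"
      by (elim exE conjE)
    note facts = H basis unit[rule_format] \<kappa>[rule_format, THEN conjunct1]
      \<kappa>[rule_format, THEN conjunct2, rule_format]
    show ?case
      unfolding state_to_output_decoupling_def Let_def dims
    proof (rule exI[of _ \<nu>], rule exI[of _ \<Lambda>], rule exI[of _ \<kappa>], rule exI[of _ v],
        intro conjI ballI allI impI)
      fix x \<xi>
      assume "x \<in> carrier_vec n" "trajectory td ?M x \<xi>"
      with facts show "\<exists>\<beta>. admissible_coefficients p \<nu> \<Lambda> \<kappa> \<beta> \<and> modal_error td ?H \<nu> \<Lambda> \<beta> \<xi>"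
        by (rule modal_expansion)
    next
      fix \<beta>
      assume "admissible_coefficients p \<nu> \<Lambda> \<kappa> \<beta>"
      with facts show "\<exists>x \<in> carrier_vec n. \<exists>\<xi>. trajectory td ?M x \<xi> \<and> modal_error td ?H \<nu> \<Lambda> \<beta> \<xi>"
        by (rule modal_realization)
    qed (rule basis)
  qed
qed

end
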